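(* Let $BW_{16}\subset\mathbb{R}^{16}$ be the lattice defined in the context. Every integral lattice $M\subset\mathbb{R}^{16}$ with $BW_{16}\subseteq M$ is isometric to one of the following ten lattices: $BW_{16}$, $O_{16}$, $\Lambda_{16,2,1}$, $\Lambda_{16,2,2}$, $\Lambda_{16,2,3}$, ${\Lambda_{16,2,1}}'$, ${\Lambda_{16,2,2}}'$, ${\Lambda_{16,2,3}}'$, $\bm{D}_{16}^{+}$, $\bm{E}_8\perp\bm{E}_8$.
   Context: A lattice is integral if $(x,y)\in\mathbb{Z}$ for all its vectors $x,y$. Let $\varepsilon_1,\dots,\varepsilon_{16}$ be the standard orthonormal basis of $\mathbb{R}^{16}$, and $\langle S\rangle$ the lattice generated by $S$. Put $f_0=\tfrac12(-\varepsilon_1+\varepsilon_2+\dots+\varepsilon_8-\varepsilon_9+\varepsilon_{10}+\dots+\varepsilon_{16})$, $f_1=\tfrac12(\varepsilon_1+\dots+\varepsilon_8)+\varepsilon_9$, $f_2=\tfrac12(-\varepsilon_1+\varepsilon_2+\dots+\varepsilon_8)$, $g_1=\varepsilon_1+\varepsilon_5+\varepsilon_9+\varepsilon_{13}$, $g_2=\varepsilon_1+\varepsilon_3+\varepsilon_5+\varepsilon_7$, $g_3=\varepsilon_1+\varepsilon_3+\varepsilon_9+\varepsilon_{11}$, $g_4=\varepsilon_1+\varepsilon_3+\varepsilon_{13}+\varepsilon_{15}$, $g_5=\varepsilon_1+\varepsilon_2+\varepsilon_3+\varepsilon_4$, $g_6=\varepsilon_1+\varepsilon_2+\varepsilon_5+\varepsilon_6$,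 $g_7=\varepsilon_1+\varepsilon_2+\varepsilon_7+\varepsilon_8$, $g_8=\varepsilon_1+\varepsilon_2+\varepsilon_9+\varepsilon_{10}$, $g_9=\varepsilon_1+\varepsilon_2+\varepsilon_{11}+\varepsilon_{12}$, $g_{10}=\varepsilon_1+\varepsilon_2+\varepsilon_{13}+\varepsilon_{14}$, $g_{11}=\varepsilon_1+\varepsilon_2+\varepsilon_{15}+\varepsilon_{16}$. Let $(A_1)^{16}=\{\pm(\varepsilon_{2i-1}\pm\varepsilon_{2i}):1\le i\le 8\}$; $(D_4)^4=\{\pm(\varepsilon_i\pm\varepsilon_j): 4k-3\le i<j\le 4k,\ 1\le k\le 4\}$; $D_8\perp D_8=\{\pm(\varepsilon_i\pm\varepsilon_j): 1\le i<j\le 8 \text{ or } 9\le i<j\le 16\}$; $D_{16}=\{\pm(\varepsilon_i\pm\varepsilon_j):1\le i<j\le16\}$. Define: $BW_{16}=\langle 2\varepsilon_1,\dots,2\varepsilon_{16},f_0,g_1,\dots,g_{11}\rangle$ (the Barnes–Wall lattice); $O_{16}=\langle 2\varepsilon_1,\dots,2\varepsilon_{16},f_0,f_1,g_1,\dots,g_{11}\rangle$; $\Lambda_{16,2,1}=\langle (A_1)^{16},f_0,f_1,g_1,g_2,g_3,g_4\rangle$, $\Lambda_{16,2,2}=\langle (D_4)^4,f_0,f_1,g_1\rangle$, $\Lambda_{16,2,3}=\langle D_8\perp D_8,f_0,f_1\rangle$; ${\Lambda_{16,2,1}}'=\langle (A_1)^{16},f_0,g_1,g_2,g_3,g_4\rangle$,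 ${\Lambda_{16,2,2}}'=\langle (D_4)^4,f_0,g_1\rangle$, ${\Lambda_{16,2,3}}'=\langle D_8\perp D_8,f_0\rangle$; $\bm{D}_{16}^{+}=\langle D_{16},f_0\rangle$; $\bm{E}_8\perp\bm{E}_8=\langle D_8\perp D_8,f_0,f_2\rangle$ (the orthogonal sum of two copies of the $E_8$ root lattice). *)

theory Defs
  imports "HOL-Analysis.Analysis"
begin

text \<open>Real vector spaces as modules over the integers: \<open>zmodule.span S\<close> is the additive
  subgroup of all integral linear combinations of elements of \<open>S\<close>.\<close>

global_interpretation zmodule: module "\<lambda>(k::int) (x::'a::real_vector). of_int k *\<^sub>R x"
  by unfold_locales (simp_all add: algebra_simps)

text \<open>Lattices need not have full rank.\<close>

definition is_lattice :: "('a::euclidean_space) set \<Rightarrow> bool" where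
  "is_lattice L \<longleftrightarrow> (\<exists>B. independent B \<and> L = zmodule.span B)"

definition integral_lattice :: "('a::euclidean_space) set \<Rightarrow> bool" where
  "integral_lattice L \<longleftrightarrow> is_lattice L \<and> (\<forall>x\<in>L. \<forall>y\<in>L. x \<bullet> y \<in> \<int>)"

text \<open>Isometry realised by an orthogonal map of the ambient space. For lattices of full rank this
  is the same as an isomorphism of groups preserving the inner product, since such an isomorphism
  extends uniquely to the ambient space.\<close>

definition isometric :: "('a::euclidean_space) set \<Rightarrow> 'a set \<Rightarrow> bool" where
  "isometric L M \<longleftrightarrow> (\<exists>h. orthogonal_transformation h \<and> h ` L = M)"

text \<open>The indices \<open>1, \<dots>, 16\<close> are natural numbers, so that their order is the usual one. As
  elements of the index type \<open>16\<close> they are pairwise different, \<open>16\<close> being the same as \<open>0\<close>.\<close>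

definition \<epsilon> :: "nat \<Rightarrow> real ^ 16" where
  "\<epsilon> i = axis (of_nat i) 1"

definition f\<^sub>0 :: "real ^ 16" where
  "f\<^sub>0 = (1/2) *\<^sub>R (- \<epsilon> 1 + (\<Sum>i=2..8. \<epsilon> i) - \<epsilon> 9 + (\<Sum>i=10..16. \<epsilon> i))"

definition f\<^sub>1 :: "real ^ 16" where
  "f\<^sub>1 = (1/2) *\<^sub>R (\<Sum>i=1..8. \<epsilon> i) + \<epsilon> 9"

definition f\<^sub>2 :: "real ^ 16" where
  "f\<^sub>2 = (1/2) *\<^sub>R (- \<epsilon> 1 + (\<Sum>i=2..8. \<epsilon> i))"

definition "g\<^sub>1 = \<epsilon> 1 + \<epsilon> 5 + \<epsilon> 9 + \<epsilon> 13"
definition "g\<^sub>2 = \<epsilon> 1 + \<epsilon> 3 + \<epsilon> 5 + \<epsilon> 7"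
definition "g\<^sub>3 = \<epsilon> 1 + \<epsilon> 3 + \<epsilon> 9 + \<epsilon> 11"
definition "g\<^sub>4 = \<epsilon> 1 + \<epsilon> 3 + \<epsilon> 13 + \<epsilon> 15"
definition "g\<^sub>5 = \<epsilon> 1 + \<epsilon> 2 + \<epsilon> 3 + \<epsilon> 4"
definition "g\<^sub>6 = \<epsilon> 1 + \<epsilon> 2 + \<epsilon> 5 + \<epsilon> 6"
definition "g\<^sub>7 = \<epsilon> 1 + \<epsilon> 2 + \<epsilon> 7 + \<epsilon> 8"
definition "g\<^sub>8 = \<epsilon> 1 + \<epsilon> 2 + \<epsilon> 9 + \<epsilon> 10"
definition "g\<^sub>9 = \<epsilon> 1 + \<epsilon> 2 + \<epsilon> 11 + \<epsilon> 12"
definition "g\<^sub>1\<^sub>0 = \<epsilon> 1 + \<epsilon> 2 + \<epsilon> 13 + \<epsilon> 14"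
definition "g\<^sub>1\<^sub>1 = \<epsilon> 1 + \<epsilon> 2 + \<epsilon> 15 + \<epsilon> 16"

text \<open>The four vectors \<open>\<plusminus>(\<epsilon>\<^sub>i \<plusminus> \<epsilon>\<^sub>j)\<close>.\<close>

definition pm :: "nat \<Rightarrow> nat \<Rightarrow> (real ^ 16) set" where
  "pm i j = {\<epsilon> i + \<epsilon> j, \<epsilon> i - \<epsilon> j, - (\<epsilon> i + \<epsilon> j), - (\<epsilon> i - \<epsilon> j)}"

definition A1_16 :: "(real ^ 16) set" where
  "A1_16 = (\<Union>i\<in>{1..8}. pm (2 * i - 1) (2 * i))"

definition D4_4 :: "(real ^ 16) set" where
  "D4_4 = \<Union> {pm i j | i j k. 4 * k - 3 \<le> i \<and> i < j \<and> j \<le> 4 * k \<and> 1 \<le> k \<and> k \<le> 4}"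

definition D8_D8 :: "(real ^ 16) set" where
  "D8_D8 = \<Union> {pm i j | i j. (1 \<le> i \<and> i < j \<and> j \<le> 8) \<or> (9 \<le> i \<and> i < j \<and> j \<le> 16)}"

definition D16 :: "(real ^ 16) set" where
  "D16 = \<Union> {pm i j | i j. 1 \<le> i \<and> i < j \<and> j \<le> 16}"

definition BW16 :: "(real ^ 16) set" where
  "BW16 = zmodule.span ({2 *\<^sub>R \<epsilon> i | i. 1 \<le> i \<and> i \<le> 16} \<union>
     {f\<^sub>0, g\<^sub>1, g\<^sub>2, g\<^sub>3, g\<^sub>4, g\<^sub>5, g\<^sub>6, g\<^sub>7, g\<^sub>8, g\<^sub>9, g\<^sub>1\<^sub>0, g\<^sub>1\<^sub>1})"

definition O16 :: "(real ^ 16) set" where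
  "O16 = zmodule.span ({2 *\<^sub>R \<epsilon> i | i. 1 \<le> i \<and> i \<le> 16} \<union>
     {f\<^sub>0, f\<^sub>1, g\<^sub>1, g\<^sub>2, g\<^sub>3, g\<^sub>4, g\<^sub>5, g\<^sub>6, g\<^sub>7, g\<^sub>8, g\<^sub>9, g\<^sub>1\<^sub>0, g\<^sub>1\<^sub>1})"

definition \<Lambda>21 :: "(real ^ 16) set" where
  "\<Lambda>21 = zmodule.span (A1_16 \<union> {f\<^sub>0, f\<^sub>1, g\<^sub>1, g\<^sub>2, g\<^sub>3, g\<^sub>4})"

definition \<Lambda>22 :: "(real ^ 16) set" where
  "\<Lambda>22 = zmodule.span (D4_4 \<union> {f\<^sub>0, f\<^sub>1, g\<^sub>1})"

definition \<Lambda>23 :: "(real ^ 16) set" where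
  "\<Lambda>23 = zmodule.span (D8_D8 \<union> {f\<^sub>0, f\<^sub>1})"

definition \<Lambda>21' :: "(real ^ 16) set" where
  "\<Lambda>21' = zmodule.span (A1_16 \<union> {f\<^sub>0, g\<^sub>1, g\<^sub>2, g\<^sub>3, g\<^sub>4})"

definition \<Lambda>22' :: "(real ^ 16) set" where
  "\<Lambda>22' = zmodule.span (D4_4 \<union> {f\<^sub>0, g\<^sub>1})"

definition \<Lambda>23' :: "(real ^ 16) set" where
  "\<Lambda>23' = zmodule.span (D8_D8 \<union> {f\<^sub>0})"

definition D16_plus :: "(real ^ 16) set" where
  "D16_plus = zmodule.span (D16 \<union> {f\<^sub>0})"

definition E8_E8 :: "(real ^ 16) set" where
  "E8_E8 = zmodule.span (D8_D8 \<union> {f\<^sub>0, f\<^sub>2})"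

end

theory Submission
  imports Defs
begin

text \<open>An integral lattice containing \<open>BW16\<close> lies in the dual lattice of \<open>BW16\<close>. The quotient of the
  dual by \<open>BW16\<close> is \<open>\<bbbF>\<^sub>2\<^sup>8\<close>, with the hyperbolic quadratic form given by the norm modulo 2, and integral
  overlattices correspond to subspaces that are totally isotropic for its polar form. If the dual
  contains four orthogonal vectors of norm 2 in one class \<open>u\<close> whose half-sum is in the class \<open>w\<close>, then
  the negation on their span preserves \<open>BW16\<close> and acts as the Siegel transformation of \<open>u\<close> and \<open>w\<close>.
  Twelve such transformations suffice to move any singular vector orthogonal to the first \<open>j\<close> vectors
  of a fixed maximal singular flag, and outside their span, to the next vector of the flag, and any
  nonsingular one to the class of \<open>f\<^sub>1\<close>, while fixing these \<open>j\<close> vectors. So every isotropic subspace can be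
  brought into one of ten standard positions.\<close>

section \<open>Coordinates\<close>

text \<open>With the coordinates numbered by F_2^4, the supports of the \<open>g\<close> vectors are
  planes spanning the Reed-Muller code RM(2,4). The discriminant group is RM(3,4)/RM(2,4), given by
  pairs of coordinates, plus RM(1,4)/RM(0,4), given by halves of hyperplanes: two maximal totally
  singular subspaces in duality. Siegel transformations preserve each of the two families of maximal
  totally singular subspaces. These belong to \<open>D16_plus\<close> and \<open>E8_E8\<close>,
  which are not isometric, so no isometry could interchange them. Transport along the flag therefore
  stops after three vectors; there remains a hyperbolic plane whose singular lines, the classes of
  \<epsilon> 1 + \<epsilon> 9 and \<open>f\<^sub>2\<close>, need separate treatment. The number ten
  arises because the norm modulo 2 is additive on an isotropic subspace. If it vanishes, the
  dimension is 0 to 3, or 4 with two families; otherwise its kernel is a hyperplane of dimension 0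
  to 3. Witt's theorem would not tell which isometries lift to \<open>BW16\<close>. Hence the orbits
  are found with explicit liftable moves, checked on all relevant classes by evaluation.\<close>

lemma bij_of_nat_16: "bij_betw (of_nat :: nat \<Rightarrow> 16) {1..16} UNIV"
proof -
  have "x \<in> of_nat ` {1..16}" for x :: 16
  proof (cases x)
    case (of_int z)
    then have z: "0 \<le> z" "z < 16" by simp_all
    show ?thesis
    proof (cases "z = 0")
      case True
      then have "x = of_nat 16" using of_int by simp
      then show ?thesis by (rule image_eqI) simp
    next
      case False
      then have "x = of_nat (nat z)" "nat z \<in> {1..16}" using of_int z by auto
      then show ?thesis by blast
    qed
  qed
  then have surj: "(of_nat :: nat \<Rightarrow> 16) ` {1..16} = UNIV" by blast
  then have "inj_on (of_nat :: nat \<Rightarrow> 16) {1..16}"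
    by (intro eq_card_imp_inj_on) (simp, unfold surj, simp)
  with surj show ?thesis by (simp add: bij_betw_def)
qed

lemma inner_\<epsilon>:
  assumes "i < 16" "j < 16"
  shows "\<epsilon> (Suc i) \<bullet> \<epsilon> (Suc j) = of_bool (i = j)"
proof -
  have "(of_nat (Suc i) :: 16) = of_nat (Suc j) \<longleftrightarrow> Suc i = Suc j"
    by (rule inj_on_eq_iff[OF bij_betw_imp_inj_on[OF bij_of_nat_16]]) (use assms in auto)
  note eq = this
  show ?thesis
    unfolding \<epsilon>_def inner_axis_axis eq by simp
qed

lemma eq_if_inner_\<epsilon>_eq:
  assumes "\<And>i. i < 16 \<Longrightarrow> x \<bullet> \<epsilon> (Suc i) = y \<bullet> \<epsilon> (Suc i)"
  shows "x = y"
proof -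
  have "x $ k = y $ k" for k
  proof -
    obtain n where n: "k = of_nat n" "n \<in> {1..16}"
      using bij_betw_imp_surj_on[OF bij_of_nat_16] by blast
    then have "Suc (n - 1) = n" "n - 1 < 16" by auto
    then show ?thesis
      using assms[of "n - 1"] n by (simp add: \<epsilon>_def inner_axis)
  qed
  then show ?thesis by (simp add: vec_eq_iff)
qed

text \<open>Every vector below has half-integral coordinates; it is represented by the list of its
  doubled coordinates.\<close>

definition half_vec :: "int list \<Rightarrow> real ^ 16" where
  "half_vec xs = (1/2) *\<^sub>R (\<Sum>i<16. of_int (xs ! i) *\<^sub>R \<epsilon> (Suc i))"

definition dot :: "int list \<Rightarrow> int list \<Rightarrow> int" where
  "dot xs ys = (\<Sum>(x, y)\<leftarrow>zip xs ys. x * y)"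

definition lincomb :: "(int \<times> int list) list \<Rightarrow> int list" where
  "lincomb ps = foldr (\<lambda>(k, v). map2 (\<lambda>a b. k * a + b) v) ps (replicate 16 0)"

lemma inner_half_vec_\<epsilon>: "i < 16 \<Longrightarrow> half_vec xs \<bullet> \<epsilon> (Suc i) = of_int (xs ! i) / 2"
  by (simp add: half_vec_def inner_sum_left inner_\<epsilon> if_distrib sum.delta cong: if_cong)

lemma inner_half_vec:
  assumes "length xs = 16" "length ys = 16"
  shows "half_vec xs \<bullet> half_vec ys = of_int (dot xs ys) / 4"
proof -
  have "half_vec xs \<bullet> half_vec ys = (\<Sum>i<16. of_int (ys ! i) / 2 * (half_vec xs \<bullet> \<epsilon> (Suc i)))"
    by (subst (2) half_vec_def) (simp add: inner_sum_right sum_distrib_left)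
  also have "\<dots> = (\<Sum>i<16. of_int (xs ! i * ys ! i)) / 4"
    by (simp add: inner_half_vec_\<epsilon> sum_divide_distrib mult.commute)
  also have "(\<Sum>i<16. of_int (xs ! i * ys ! i) :: real) = of_int (dot xs ys)"
    using assms by (simp add: dot_def sum_list_sum_nth atLeast0LessThan)
  finally show ?thesis .
qed

lemma lincomb_Cons: "lincomb ((k, v) # ps) = map2 (\<lambda>a b. k * a + b) v (lincomb ps)"
  by (simp add: lincomb_def)

lemma length_lincomb: "\<forall>v\<in>snd ` set ps. length v = 16 \<Longrightarrow> length (lincomb ps) = 16"
  by (induction ps) (auto simp: lincomb_Cons, simp add: lincomb_def)

lemma half_vec_lincomb:
  assumes "\<forall>v\<in>snd ` set ps. length v = 16"
  shows "half_vec (lincomb ps) = (\<Sum>(k, v)\<leftarrow>ps. of_int k *\<^sub>R half_vec v)"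
  using assms
proof (induction ps)
  case Nil
  show ?case by (simp add: lincomb_def half_vec_def)
next
  case (Cons p ps)
  obtain k v where p: "p = (k, v)" by fastforce
  have len: "length v = 16" "length (lincomb ps) = 16"
    using Cons.prems p by (auto intro!: length_lincomb)
  have "half_vec (lincomb (p # ps)) = of_int k *\<^sub>R half_vec v + half_vec (lincomb ps)"
    using len
    by (simp add: half_vec_def p lincomb_Cons scaleR_add_left sum.distrib scaleR_sum_right
        scaleR_add_right mult_ac)
  with Cons p show ?case by simp
qed

definition supp :: "nat list \<Rightarrow> int list" where
  "supp ks = map (\<lambda>i. if i \<in> set ks then 2 else 0) [1..<17]"

lemma half_vec_map:
  "half_vec (map c [1..<17]) = (1/2) *\<^sub>R (\<Sum>i=1..16. of_int (c i) *\<^sub>R \<epsilon> i)"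
proof -
  have "(\<Sum>i=1..16. of_int (c i) *\<^sub>R \<epsilon> i) = (\<Sum>i<16. of_int (c (Suc i)) *\<^sub>R \<epsilon> (Suc i))"
    by (rule sum.reindex_bij_witness[of _ Suc "\<lambda>i. i - 1"]) auto
  then show ?thesis
    by (simp add: half_vec_def del: upt.simps upt_rec_numeral)
qed

lemma half_vec_supp:
  assumes "distinct ks" "set ks \<subseteq> {1..16}"
  shows "half_vec (supp ks) = (\<Sum>k\<leftarrow>ks. \<epsilon> k)"
proof -
  have "(\<Sum>i=1..16. of_int (if i \<in> set ks then 2 else 0) *\<^sub>R \<epsilon> i) = (\<Sum>i\<in>set ks. 2 *\<^sub>R \<epsilon> i)"
    using assms(2) by (intro sum.mono_neutral_cong_right) auto
  also have "\<dots> = 2 *\<^sub>R (\<Sum>k\<leftarrow>ks. \<epsilon> k)"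
    by (simp add: scaleR_sum_right sum_list_distinct_conv_sum_set[OF assms(1)])
  finally show ?thesis
    unfolding supp_def half_vec_map by simp
qed

text \<open>The coordinates of \<open>2 f\<^sub>0\<close> are signs; the other half-integral vectors below carry the same
  signs.\<close>

definition signed :: "(nat \<Rightarrow> int) \<Rightarrow> int list" where
  "signed \<phi> = map (\<lambda>i. if i \<in> {1, 9} then - \<phi> (i - 1) else \<phi> (i - 1)) [1..<17]"

text \<open>Half of the hyperplane of F_2^4 on which bit \<open>i\<close> vanishes; these
  hyperplanes and the all-one word generate RM(1,4).\<close>

definition half :: "nat \<Rightarrow> int list" where
  "half i = signed (\<lambda>x. of_bool (even (x div 2 ^ i)))"

lemma f\<^sub>0_eq: "f\<^sub>0 = half_vec (signed (\<lambda>_. 1))"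
proof -
  have "{1..16::nat} = {1,9} \<union> ({2..8} \<union> {10..16})" by auto
  then have "(\<Sum>i=1..16. of_int (if i \<in> {1, 9} then - 1 else 1) *\<^sub>R \<epsilon> i) =
      (\<Sum>i\<in>{1,9}. of_int (if i \<in> {1, 9} then - 1 else 1) *\<^sub>R \<epsilon> i) +
      ((\<Sum>i=2..8. of_int (if i \<in> {1, 9} then - 1 else 1) *\<^sub>R \<epsilon> i) +
      (\<Sum>i=10..16. of_int (if i \<in> {1, 9} then - 1 else 1) *\<^sub>R \<epsilon> i))"
    by (simp only:) (subst sum.union_disjoint; auto)+
  note split = this
  show ?thesis
    unfolding f\<^sub>0_def signed_def half_vec_map split by (simp add: algebra_simps)
qed

lemma f\<^sub>2_eq: "f\<^sub>2 = half_vec (half 3)"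
proof -
  let ?c = "\<lambda>i::nat. if i \<in> {1, 9} then - of_bool (even ((i - 1) div 2 ^ 3))
    else of_bool (even ((i - 1) div 2 ^ 3)) :: int"
  have *: "?c i = (if i = 1 then - 1 else 1)" if "i \<in> {1..8}" for i
  proof -
    have "(i - 1) div 2 ^ 3 = 0" using that by auto
    then show ?thesis using that by auto
  qed
  have **: "?c i = 0" if "i \<in> {1..16} - {1..8}" for i
  proof -
    have "(i - 1) div 2 ^ 3 = 1" using that by auto
    then show ?thesis by simp
  qed
  have "(\<Sum>i=1..16. of_int (?c i) *\<^sub>R \<epsilon> i) = (\<Sum>i=1..8. of_int (?c i) *\<^sub>R \<epsilon> i)"
  proof (rule sum.mono_neutral_right)
    show "\<forall>i\<in>{1..16} - {1..8}. of_int (?c i) *\<^sub>R \<epsilon> i = 0"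
    proof
      fix i :: nat assume "i \<in> {1..16} - {1..8}"
      from **[OF this] show "of_int (?c i) *\<^sub>R \<epsilon> i = 0" by (simp only: of_int_0 scaleR_zero_left)
    qed
  qed auto
  also have "\<dots> = (\<Sum>i=1..8. of_int (if i = 1 then - 1 else 1) *\<^sub>R \<epsilon> i)"
    by (intro sum.cong refl) (simp only: *)
  also have "\<dots> = - \<epsilon> 1 + (\<Sum>i=2..8. \<epsilon> i)"
  proof -
    have "{1..8::nat} = insert 1 {2..8}" by auto
    then show ?thesis by simp
  qed
  finally show ?thesis
    unfolding f\<^sub>2_def half_def signed_def half_vec_map by simp
qed

section \<open>Membership in the Barnes-Wall lattice\<close>

text \<open>The order matters for explicit indices: position 0 is \<open>f\<^sub>0\<close>,
  positions 1 to 11 are the \<open>g\<close> vectors in order, and position 11 + i is twice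
  \<epsilon> i.\<close>

definition bw_gens :: "int list list" where
  "bw_gens = signed (\<lambda>_. 1) #
    map supp [[1, 5, 9, 13], [1, 3, 5, 7], [1, 3, 9, 11], [1, 3, 13, 15], [1, 2, 3, 4], [1, 2, 5, 6],
      [1, 2, 7, 8], [1, 2, 9, 10], [1, 2, 11, 12], [1, 2, 13, 14], [1, 2, 15, 16]] @
    map (\<lambda>i. map ((*) 2) (supp [i])) [1..<17]"

text \<open>The classes of these vectors modulo \<open>BW16\<close> form a hyperbolic basis of the discriminant group, in
  which the \<open>p\<close>-th vector is dual to the vector number \<open>p + 4\<close> modulo 8. The last one is \<open>f\<^sub>2\<close>.\<close>

definition glue :: "int list list" where
  "glue = map supp [[1, 2], [1, 3], [1, 5], [1, 9]] @ map half [0..<4]"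

lemma half_vec_double:
  assumes "length xs = 16"
  shows "half_vec (map ((*) 2) xs) = 2 *\<^sub>R half_vec xs"
  using assms by (simp add: half_vec_def scaleR_sum_right)

lemma BW16_eq: "BW16 = zmodule.span (half_vec ` set bw_gens)"
proof -
  have "half_vec (map ((*) 2) (supp [i])) = 2 *\<^sub>R \<epsilon> i" if "1 \<le> i" "i \<le> 16" for i
    using that by (simp add: half_vec_double half_vec_supp supp_def[THEN arg_cong[where f = length]])
  then have "(\<lambda>i. half_vec (map ((*) 2) (supp [i]))) ` {1..<17} = {2 *\<^sub>R \<epsilon> i | i. 1 \<le> i \<and> i \<le> 16}"
    by (force simp: image_def)
  then show ?thesis
    unfolding BW16_def bw_gens_def
    by (intro arg_cong[where f = zmodule.span])
      (simp add: image_image half_vec_supp f\<^sub>0_eq g\<^sub>1_def g\<^sub>2_def g\<^sub>3_def g\<^sub>4_def g\<^sub>5_def g\<^sub>6_def g\<^sub>7_def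
        g\<^sub>8_def g\<^sub>9_def g\<^sub>1\<^sub>0_def g\<^sub>1\<^sub>1_def add.assoc Un_commute del: upt.simps upt_rec_numeral)
qed

text \<open>A \<int>-basis of \<open>BW16\<close>. Among the \<open>g\<close> vectors only
  \<open>g\<^sub>8\<close> is left out: twice \<open>f\<^sub>0\<close> supplies the all-one word of
  RM(2,4) in its place.\<close>

definition bw_basis :: "int list list" where
  "bw_basis = map ((!) bw_gens) [12, 13, 14, 20, 24, 0, 1, 2, 3, 4, 5, 6, 7, 9, 10, 11]"

text \<open>Row by row the dual basis of \<open>bw_basis\<close>, in doubled coordinates.\<close>

definition dual_basis :: "int list list" where
  "dual_basis =
  [[1, 0, 0, -1, -1, 0, 0, -1, 0, 7, -1, 0, 0, -1, -1, 0],
   [0, 1, 0, -1, 0, -1, 0, -1, 0, 5, 0, -1, 0, -1, 0, -1],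
   [0, 0, 1, -1, 0, 0, -1, 1, 0, 0, -1, 1, 0, 0, -1, 1],
   [0, 0, 0, 0, -1, 1, 1, -1, 1, 1, -1, 1, 0, 0, 0, 0],
   [0, 0, 0, 0, -1, 1, 1, -1, 0, 0, 0, 0, 1, -1, -1, 1],
   [0, 0, 0, 0, 0, 0, 0, 0, 0, 4, 0, 0, 0, 0, 0, 0],
   [0, 0, 0, 0, 2, -2, -2, 2, 0, 0, 0, 0, 0, 0, 0, 0],
   [0, 0, 0, 0, 0, 0, 2, -2, 0, 0, 0, 0, 0, 0, 0, 0],
   [0, 0, 0, 0, 0, 0, 0, 0, 0, 0, 2, -2, 0, 0, 0, 0],
   [0, 0, 0, 0, 0, 0, 0, 0, 0, 0, 0, 0, 0, 0, 2, -2],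
   [0, 0, 0, 2, 0, 0, 0, 0, 0, -2, 0, 0, 0, 0, 0, 0],
   [0, 0, 0, 0, 0, 2, 0, 0, 0, -2, 0, 0, 0, 0, 0, 0],
   [0, 0, 0, 0, 0, 0, 0, 2, 0, -2, 0, 0, 0, 0, 0, 0],
   [0, 0, 0, 0, 0, 0, 0, 0, 0, -2, 0, 2, 0, 0, 0, 0],
   [0, 0, 0, 0, 0, 0, 0, 0, 0, -2, 0, 0, 0, 2, 0, 0],
   [0, 0, 0, 0, 0, 0, 0, 0, 0, -2, 0, 0, 0, 0, 0, 2]]"

text \<open>A certificate that the dual lattice is generated by \<open>BW16\<close> and the glue
  vectors: each row has 28 coefficients for \<open>bw_gens\<close> and 8 for
  \<open>glue\<close>.\<close>

lemma dual_basis_eq_lincomb: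
  "dual_basis = map (\<lambda>cs. lincomb (zip cs (bw_gens @ glue)))
  [[0, -1, 1, 0, 0, 0, 1, 0, 0, 0, 0, 0, -1, 0, 0, 0, 0, 0, 0, 0, 0, 2, 0, 0, 1, 0, 0, 0, 0, 0, 0, 0, -1, -1, 0, -1],
   [-1, 0, 0, 0, 0, 0, 0, 0, 1, 0, 0, 0, 0, 0, 0, 0, 0, 0, 0, 0, 0, 1, 0, 0, 0, 0, 0, 0, 0, 0, 0, -1, 1, 0, 0, 0],
   [1, 1, -1, -1, -1, -1, 0, 0, 0, 0, 0, 0, 1, 0, 2, 0, 0, 0, 0, 0, 0, 0, 0, 0, 0, 0, 0, 0, 1, 0, 0, 0, 0, -1, 0, 0],
   [0, 0, 1, -1, 0, 0, 1, 0, 0, 0, 0, 0, 0, 0, 0, 0, -1, 0, 0, 0, 1, 0, 0, 0, 0, 0, 0, 0, -1, 0, 0, 0, 0, 0, 1, -1],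
   [1, 0, 1, 0, -1, 0, 0, -1, 0, 0, 1, 0, 0, 0, 0, 0, -1, 0, 0, 0, 0, 0, 0, 0, 0, -1, 0, 0, 0, 0, 0, 0, 0, 0, -1, 0],
   [0, 0, 0, 0, 0, 0, 0, 0, 0, 0, 0, 0, 0, 0, 0, 0, 0, 0, 0, 0, 0, 1, 0, 0, 0, 0, 0, 0, 0, 0, 0, 0, 0, 0, 0, 0],
   [0, 0, 0, 0, 0, 0, 1, -1, 0, 0, 0, 0, 0, 0, 0, 0, 0, -1, 0, 1, 0, 0, 0, 0, 0, 0, 0, 0, 0, 0, 0, 0, 0, 0, 0, 0],
   [0, 0, 0, 0, 0, 0, 0, 1, 0, 0, 0, 0, 0, 0, 0, 0, 0, 0, 0, -1, 0, 0, 0, 0, 0, 0, 0, 0, -1, 0, 0, 0, 0, 0, 0, 0],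
   [0, 0, 0, 0, 0, 0, 0, 0, 0, 1, 0, 0, 0, 0, 0, 0, 0, 0, 0, 0, 0, 0, 0, -1, 0, 0, 0, 0, -1, 0, 0, 0, 0, 0, 0, 0],
   [0, 0, 0, 0, 0, 0, 0, 0, 0, 0, 0, 1, 0, 0, 0, 0, 0, 0, 0, 0, 0, 0, 0, 0, 0, 0, 0, -1, -1, 0, 0, 0, 0, 0, 0, 0],
   [0, 0, 0, 0, 0, 1, 0, 0, -1, 0, 0, 0, 0, 0, 0, 0, 0, 0, 0, 0, 0, 0, 0, 0, 0, 0, 0, 0, 0, -1, 0, 1, 0, 0, 0, 0],
   [0, 0, 0, 0, 0, 0, 1, 0, -1, 0, 0, 0, 0, 0, 0, 0, 0, 0, 0, 0, 0, 0, 0, 0, 0, 0, 0, 0, 0, 0, -1, 1, 0, 0, 0, 0],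
   [0, 0, 1, 0, 0, 0, 0, 1, -1, 0, 0, 0, 0, 0, 0, 0, 0, 0, -1, 0, 0, 0, 0, 0, 0, 0, 0, 0, 0, -1, -1, 1, 0, 0, 0, 0],
   [0, 0, 0, 1, 0, 0, 0, 0, -1, 1, 0, 0, 0, 0, 0, 0, 0, 0, 0, 0, 0, 0, -1, 0, 0, 0, 0, 0, 0, -1, 0, 0, 0, 0, 0, 0],
   [0, 1, 0, 0, 0, 0, 0, 0, -1, 0, 1, 0, 0, 0, 0, 0, 0, 0, 0, 0, 0, 0, 0, 0, -1, 0, 0, 0, 0, 0, -1, 0, 0, 0, 0, 0],
   [0, 1, 0, 0, -1, 0, 0, 0, -1, 0, 0, 1, 0, 0, 0, 0, 0, 0, 0, 0, 0, 0, 0, 0, 0, 0, 0, 0, 0, 1, -1, 0, 0, 0, 0, 0]]"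
  by code_simp

text \<open>Duality of the two bases as a matrix identity. The 4 is the identity matrix after both
  factors have been doubled.\<close>

lemma dual_basis_expansion:
  "map (\<lambda>n. lincomb (map (\<lambda>(u, b). (b ! n, u)) (zip dual_basis bw_basis))) [0..<16] =
    map (\<lambda>n. (replicate 16 0)[n := 4]) [0..<16]"
  by code_simp

lemma length_coords:
  "\<forall>xs\<in>set bw_gens. length xs = 16" "\<forall>xs\<in>set glue. length xs = 16"
  "\<forall>xs\<in>set dual_basis. length xs = 16" "length glue = 8"
  by code_simp+

lemma bw_basis_subset: "set bw_basis \<subseteq> set bw_gens"
  by code_simp

text \<open>\<open>dual_basis\<close> consists of vectors of the dual lattice of \<open>BW16\<close>, which \<open>BW16\<close> and \<open>glue\<close>
  generate. Hence \<open>BW16\<close> is the dual of its dual.\<close>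

lemma expansion_BW16: "x = (\<Sum>(u, b)\<leftarrow>zip dual_basis bw_basis. (x \<bullet> half_vec u) *\<^sub>R half_vec b)"
proof (rule eq_if_inner_\<epsilon>_eq)
  fix i :: nat assume i: "i < 16"
  let ?ps = "map (\<lambda>(u, b). (b ! i, u)) (zip dual_basis bw_basis)"
  have "lincomb ?ps = (replicate 16 0)[i := 4]"
    using arg_cong[OF dual_basis_expansion, of "\<lambda>l. l ! i"] i by simp
  moreover have "\<forall>v\<in>snd ` set ?ps. length v = 16"
    using length_coords(3) by (auto dest: set_zip_leftD)
  ultimately have "(\<Sum>(k, v)\<leftarrow>?ps. of_int k *\<^sub>R half_vec v) = half_vec ((replicate 16 0)[i := 4])"
    using half_vec_lincomb by metis
  also have "\<dots> = 2 *\<^sub>R \<epsilon> (Suc i)"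
    using i by (intro eq_if_inner_\<epsilon>_eq) (simp add: inner_half_vec_\<epsilon> inner_\<epsilon> nth_list_update)
  finally have "\<epsilon> (Suc i) = (1/2) *\<^sub>R (\<Sum>(u, b)\<leftarrow>zip dual_basis bw_basis. of_int (b ! i) *\<^sub>R half_vec u)"
    by (simp add: case_prod_beta' comp_def)
  then have "x \<bullet> \<epsilon> (Suc i) =
      x \<bullet> ((1/2) *\<^sub>R (\<Sum>(u, b)\<leftarrow>zip dual_basis bw_basis. of_int (b ! i) *\<^sub>R half_vec u))"
    by simp
  also have "\<dots> = (\<Sum>(u, b)\<leftarrow>zip dual_basis bw_basis. (x \<bullet> half_vec u) *\<^sub>R half_vec b) \<bullet> \<epsilon> (Suc i)"
  proof -
    have "x \<bullet> ((1/2) *\<^sub>R (\<Sum>(u, b)\<leftarrow>ps. of_int (b ! i) *\<^sub>R half_vec u)) =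
        (\<Sum>(u, b)\<leftarrow>ps. (x \<bullet> half_vec u) *\<^sub>R half_vec b) \<bullet> \<epsilon> (Suc i)" for ps
      using i by (induction ps) (auto simp: inner_add_left inner_add_right inner_half_vec_\<epsilon> algebra_simps)
    then show ?thesis .
  qed
  finally show "x \<bullet> \<epsilon> (Suc i) =
      (\<Sum>(u, b)\<leftarrow>zip dual_basis bw_basis. (x \<bullet> half_vec u) *\<^sub>R half_vec b) \<bullet> \<epsilon> (Suc i)" .
qed

lemma scaleR_Ints_mem_span: "k \<in> \<int> \<Longrightarrow> x \<in> zmodule.span S \<Longrightarrow> k *\<^sub>R x \<in> zmodule.span S"
  using zmodule.span_scale by (metis Ints_cases)

lemma mem_BW16_if_dual_basis:
  assumes "\<And>u. u \<in> set dual_basis \<Longrightarrow> x \<bullet> half_vec u \<in> \<int>"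
  shows "x \<in> BW16"
proof -
  have "(\<Sum>(u, b)\<leftarrow>ps. (x \<bullet> half_vec u) *\<^sub>R half_vec b) \<in> BW16"
    if "\<forall>(u, b)\<in>set ps. x \<bullet> half_vec u \<in> \<int> \<and> b \<in> set bw_gens" for ps
    using that unfolding BW16_eq
    by (induction ps)
      (auto intro!: zmodule.span_add scaleR_Ints_mem_span zmodule.span_zero intro: zmodule.span_base)
  moreover have "\<forall>(u, b)\<in>set (zip dual_basis bw_basis). x \<bullet> half_vec u \<in> \<int> \<and> b \<in> set bw_gens"
    using assms bw_basis_subset by (auto dest: set_zip_leftD set_zip_rightD)
  ultimately show ?thesis
    using expansion_BW16[of x] by metis
qed

lemma mem_BW16I:
  assumes bw: "\<And>b. b \<in> BW16 \<Longrightarrow> x \<bullet> b \<in> \<int>"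
    and glue: "\<And>d. d \<in> set glue \<Longrightarrow> x \<bullet> half_vec d \<in> \<int>"
  shows "x \<in> BW16"
proof (rule mem_BW16_if_dual_basis)
  fix u assume "u \<in> set dual_basis"
  then obtain cs where u: "u = lincomb (zip cs (bw_gens @ glue))"
    by (subst (asm) dual_basis_eq_lincomb) auto
  have gens: "x \<bullet> half_vec v \<in> \<int>" if "v \<in> set (bw_gens @ glue)" for v
    using that assms by (auto simp: BW16_eq intro: zmodule.span_base)
  have "x \<bullet> (\<Sum>(k, v)\<leftarrow>ps. of_int k *\<^sub>R half_vec v) \<in> \<int>"
    if "\<forall>v\<in>snd ` set ps. v \<in> set (bw_gens @ glue)" for ps :: "(int \<times> int list) list"
    using that by (induction ps) (auto simp: inner_add_right intro!: Ints_add Ints_mult gens)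
  moreover have "\<forall>v\<in>snd ` set (zip cs (bw_gens @ glue)). v \<in> set (bw_gens @ glue)"
    by (auto dest: set_zip_rightD)
  moreover have "\<forall>v\<in>snd ` set (zip cs (bw_gens @ glue)). length v = 16"
    using length_coords(1,2) by (auto dest!: set_zip_rightD)
  ultimately show "x \<bullet> half_vec u \<in> \<int>"
    unfolding u by (subst half_vec_lincomb) blast+
qed

text \<open>An executable membership test. Integrality turns into divisibility by 4 because
  \<open>dot\<close> is four times the inner product; the length is tested since \<open>zip\<close>
  would truncate.\<close>

definition in_bw :: "int list \<Rightarrow> bool" where
  "in_bw xs \<longleftrightarrow> length xs = 16 \<and> list_all (\<lambda>u. 4 dvd dot xs u) dual_basis"

lemma inner_half_vec_Ints_iff:
  assumes "length xs = 16" "length ys = 16"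
  shows "half_vec xs \<bullet> half_vec ys \<in> \<int> \<longleftrightarrow> 4 dvd dot xs ys"
proof -
  have "real_of_int (dot xs ys) / 4 \<in> \<int> \<longleftrightarrow> 4 dvd dot xs ys"
    using of_int_div_of_int_in_Ints_iff[where 'a = real, of "dot xs ys" 4] by simp
  then show ?thesis using assms by (simp add: inner_half_vec)
qed

lemma mem_BW16_if_in_bw: "in_bw xs \<Longrightarrow> half_vec xs \<in> BW16"
  using length_coords(3)
  by (intro mem_BW16_if_dual_basis) (auto simp: in_bw_def list_all_iff inner_half_vec_Ints_iff)

section \<open>The discriminant group and its Siegel transformations\<close>

lemma inner_half_vec_gens_glue:
  "xs \<in> set (bw_gens @ glue) \<Longrightarrow> ys \<in> set bw_gens \<Longrightarrow> half_vec xs \<bullet> half_vec ys \<in> \<int>"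
proof -
  have "\<forall>xs\<in>set (bw_gens @ glue). \<forall>ys\<in>set bw_gens. 4 dvd dot xs ys"
    by code_simp
  then show "xs \<in> set (bw_gens @ glue) \<Longrightarrow> ys \<in> set bw_gens \<Longrightarrow> ?thesis"
    using length_coords(1,2) by (auto simp: inner_half_vec_Ints_iff)
qed

definition in_dual :: "real ^ 16 \<Rightarrow> bool" where
  "in_dual x \<longleftrightarrow> (\<forall>b\<in>BW16. x \<bullet> b \<in> \<int>)"

lemma in_dual_if_gens:
  assumes "\<And>b. b \<in> set bw_gens \<Longrightarrow> x \<bullet> half_vec b \<in> \<int>"
  shows "in_dual x"
proof -
  have "x \<bullet> b \<in> \<int>" if "b \<in> zmodule.span (half_vec ` set bw_gens)" for b
    using that
    by (induction rule: zmodule.span_induct_alt) (auto simp: inner_add_right intro!: Ints_add Ints_mult assms)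
  then show ?thesis by (simp add: in_dual_def BW16_eq)
qed

lemma BW16_in_dual: "x \<in> BW16 \<Longrightarrow> in_dual x"
proof -
  have "in_dual x" if "x \<in> zmodule.span (half_vec ` set bw_gens)"
    using that
  proof (induction rule: zmodule.span_induct_alt)
    case base
    show ?case by (simp add: in_dual_def)
  next
    case (step c x y)
    then obtain xs where "x = half_vec xs" "xs \<in> set bw_gens" by blast
    then have "in_dual x"
      by (intro in_dual_if_gens) (simp add: inner_half_vec_gens_glue)
    with step show ?case
      by (auto simp: in_dual_def inner_add_left intro!: Ints_add Ints_mult)
  qed
  then show "x \<in> BW16 \<Longrightarrow> in_dual x" by (simp add: BW16_eq)
qed

lemma glue_in_dual: "d \<in> set glue \<Longrightarrow> in_dual (half_vec d)"
  by (intro in_dual_if_gens) (simp add: inner_half_vec_gens_glue)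

lemma BW16_closed:
  "0 \<in> BW16" "x \<in> BW16 \<Longrightarrow> y \<in> BW16 \<Longrightarrow> x + y \<in> BW16" "x \<in> BW16 \<Longrightarrow> y \<in> BW16 \<Longrightarrow> x - y \<in> BW16"
  "x \<in> BW16 \<Longrightarrow> - x \<in> BW16" "k \<in> \<int> \<Longrightarrow> x \<in> BW16 \<Longrightarrow> k *\<^sub>R x \<in> BW16"
  unfolding BW16_eq
  by (simp_all add: zmodule.span_zero zmodule.span_add zmodule.span_diff zmodule.span_neg scaleR_Ints_mem_span)

text \<open>For orthogonal \<open>r\<^sub>i\<close> of norm 2 this is the negation on their span.\<close>

definition reflect :: "real ^ 16 \<Rightarrow> real ^ 16 \<Rightarrow> real ^ 16 \<Rightarrow> real ^ 16 \<Rightarrow> real ^ 16 \<Rightarrow> real ^ 16" where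
  "reflect r1 r2 r3 r4 x =
    x - ((x \<bullet> r1) *\<^sub>R r1 + (x \<bullet> r2) *\<^sub>R r2 + (x \<bullet> r3) *\<^sub>R r3 + (x \<bullet> r4) *\<^sub>R r4)"

definition frame :: "real ^ 16 \<Rightarrow> real ^ 16 \<Rightarrow> real ^ 16 \<Rightarrow> real ^ 16 \<Rightarrow> bool" where
  "frame r1 r2 r3 r4 \<longleftrightarrow> r1 \<bullet> r1 = 2 \<and> r2 \<bullet> r2 = 2 \<and> r3 \<bullet> r3 = 2 \<and> r4 \<bullet> r4 = 2 \<and>
    r1 \<bullet> r2 = 0 \<and> r1 \<bullet> r3 = 0 \<and> r1 \<bullet> r4 = 0 \<and> r2 \<bullet> r3 = 0 \<and> r2 \<bullet> r4 = 0 \<and> r3 \<bullet> r4 = 0"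

lemma inner_reflect:
  assumes "frame r1 r2 r3 r4"
  shows "reflect r1 r2 r3 r4 x \<bullet> reflect r1 r2 r3 r4 y = x \<bullet> y"
  using assms unfolding frame_def reflect_def
  by (simp add: inner_diff_left inner_diff_right inner_add_left inner_add_right inner_commute algebra_simps)

lemma reflect_reflect:
  assumes "frame r1 r2 r3 r4"
  shows "reflect r1 r2 r3 r4 (reflect r1 r2 r3 r4 x) = x"
  using assms unfolding frame_def reflect_def
  by (simp add: inner_diff_left inner_add_left inner_commute algebra_simps flip: scaleR_2)

lemma linear_reflect: "linear (reflect r1 r2 r3 r4)"
  unfolding reflect_def by (intro linearI) (simp_all add: inner_add_left algebra_simps)

lemma orthogonal_transformation_reflect:
  "frame r1 r2 r3 r4 \<Longrightarrow> orthogonal_transformation (reflect r1 r2 r3 r4)"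
  by (simp add: orthogonal_transformation_def linear_reflect inner_reflect)

text \<open>On the discriminant group the reflection is the Siegel transformation attached to the line
  spanned by the class \<open>u\<close> of the frame and the class \<open>w\<close> of its half-sum.\<close>

lemma reflect_dual:
  assumes "in_dual x"
    and t: "r1 - u \<in> BW16" "r2 - u \<in> BW16" "r3 - u \<in> BW16" "r4 - u \<in> BW16"
    and w: "(1/2) *\<^sub>R (r1 + r2 + r3 + r4) - w \<in> BW16"
    and u: "2 *\<^sub>R u \<in> BW16"
  shows "x - (2 * (x \<bullet> w)) *\<^sub>R u - (2 * (x \<bullet> u)) *\<^sub>R w - reflect r1 r2 r3 r4 x \<in> BW16"
proof -
  define t1 t2 t3 t4 t where "t1 = r1 - u" "t2 = r2 - u" "t3 = r3 - u" "t4 = r4 - u"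
    "t = (1/2) *\<^sub>R (r1 + r2 + r3 + r4) - w"
  note t_def = this
  have r: "r1 = u + t1" "r2 = u + t2" "r3 = u + t3" "r4 = u + t4"
    by (simp_all add: t_def)
  have *: "x \<bullet> b \<in> \<int>" if "b \<in> BW16" for b
    using assms(1) that by (simp add: in_dual_def)
  have mem: "t1 \<in> BW16" "t2 \<in> BW16" "t3 \<in> BW16" "t4 \<in> BW16" "t \<in> BW16"
    using t w by (simp_all add: t_def)
  have "2 * (x \<bullet> u) \<in> \<int>" using *[OF u] by simp
  \<comment> \<open>The half-sum condition enters only here; it trades the sum of the
    \<open>t\<close> vectors for \<open>w\<close>.\<close>
  moreover have sum: "t1 + t2 + t3 + t4 = 2 *\<^sub>R w + 2 *\<^sub>R t - 4 *\<^sub>R u"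
    by (simp add: t_def vec_eq_iff)
  \<comment> \<open>All coefficients on the right are integers: products of \<open>x\<close> with
    \<open>BW16\<close>, or \<open>2 * (x \<bullet> u)\<close>, which is the product with twice
    \<open>u\<close>.\<close>
  have "x - (2 * (x \<bullet> w)) *\<^sub>R u - (2 * (x \<bullet> u)) *\<^sub>R w - reflect r1 r2 r3 r4 x =
    (x \<bullet> t) *\<^sub>R (2 *\<^sub>R u) + (2 * (x \<bullet> u)) *\<^sub>R t - (2 * (x \<bullet> u)) *\<^sub>R (2 *\<^sub>R u) +
     ((x \<bullet> t1) *\<^sub>R t1 + (x \<bullet> t2) *\<^sub>R t2 + (x \<bullet> t3) *\<^sub>R t3 + (x \<bullet> t4) *\<^sub>R t4)"
  proof -
    let ?S = "(x \<bullet> t1) *\<^sub>R t1 + (x \<bullet> t2) *\<^sub>R t2 + (x \<bullet> t3) *\<^sub>R t3 + (x \<bullet> t4) *\<^sub>R t4"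
    have coeff: "4 * (x \<bullet> u) + (x \<bullet> t1 + x \<bullet> t2 + x \<bullet> t3 + x \<bullet> t4) = 2 * (x \<bullet> w) + 2 * (x \<bullet> t)"
      using arg_cong[OF sum, of "inner x"] by (simp add: inner_add_right inner_diff_right)
    have "reflect r1 r2 r3 r4 x = x -
      ((4 * (x \<bullet> u) + (x \<bullet> t1 + x \<bullet> t2 + x \<bullet> t3 + x \<bullet> t4)) *\<^sub>R u + (x \<bullet> u) *\<^sub>R (t1 + t2 + t3 + t4) + ?S)"
      unfolding reflect_def r vec_eq_iff vector_add_component vector_minus_component vector_scaleR_component
      by (simp add: inner_add_right algebra_simps)
    also have "\<dots> = x - ((2 * (x \<bullet> w) + 2 * (x \<bullet> t)) *\<^sub>R u + (x \<bullet> u) *\<^sub>R (2 *\<^sub>R w + 2 *\<^sub>R t - 4 *\<^sub>R u) + ?S)"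
      unfolding coeff sum ..
    finally show ?thesis
      unfolding vec_eq_iff vector_add_component vector_minus_component vector_scaleR_component
      by (simp add: algebra_simps)
  qed
  ultimately show ?thesis
    by (simp only:) (intro BW16_closed * mem u; assumption)
qed

section \<open>Hyperbolic coordinates on the discriminant group\<close>

abbreviation d :: "nat \<Rightarrow> real ^ 16" where
  "d p \<equiv> half_vec (glue ! p)"

definition partner :: "nat \<Rightarrow> nat" where
  "partner p = (p + 4) mod 8"

lemma partner_partner [simp]: "p < 8 \<Longrightarrow> partner (partner p) = p" and partner_less [simp]: "partner p < 8"
  unfolding partner_def by presburger+

lemma in_dual_d: "p < 8 \<Longrightarrow> in_dual (d p)"
  using length_coords(4) by (simp add: glue_in_dual)

lemma inner_d_d:
  assumes "p < 8" "q < 8"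
  shows "d p \<bullet> d q - of_bool (q = partner p) / 2 \<in> \<int>"
proof -
  have "\<forall>p\<in>set [0..<8]. \<forall>q\<in>set [0..<8]. length (glue ! p) = 16 \<and>
      4 dvd dot (glue ! p) (glue ! q) - (if q = partner p then 2 else 0)"
    by code_simp
  then have len: "length (glue ! p) = 16" "length (glue ! q) = 16"
      and "4 dvd dot (glue ! p) (glue ! q) - (if q = partner p then 2 else 0)"
    using assms by simp_all
  then obtain k where "dot (glue ! p) (glue ! q) = 4 * k + (if q = partner p then 2 else 0)"
    by (metis dvdE diff_eq_eq)
  then have "d p \<bullet> d q - of_bool (q = partner p) / 2 = of_int k"
    using len by (auto simp: inner_half_vec field_simps)
  then show ?thesis by simp
qed

lemma double_d: "p < 8 \<Longrightarrow> 2 *\<^sub>R d p \<in> BW16"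
proof -
  have "\<forall>p\<in>set [0..<8]. length (glue ! p) = 16 \<and> in_bw (map ((*) 2) (glue ! p))"
    by code_simp
  then show "p < 8 \<Longrightarrow> ?thesis"
    using half_vec_double[of "glue ! p"] mem_BW16_if_in_bw by force
qed

definition glue_sum :: "(nat \<Rightarrow> int) \<Rightarrow> real ^ 16" where
  "glue_sum k = (\<Sum>p<8. of_int (k p) *\<^sub>R d p)"

text \<open>All classes have order at most two, so only parities of coefficients count.\<close>

lemma glue_sum_cong:
  assumes "\<And>p. p < 8 \<Longrightarrow> even (k p - l p)"
  shows "glue_sum k - glue_sum l \<in> BW16"
proof -
  have "of_int (k p - l p) *\<^sub>R d p \<in> BW16" if "p < 8" for p
  proof -
    have "even (k p - l p)" using that by (rule assms)
    then obtain m where "k p - l p = 2 * m" by blast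
    then have "of_int (k p - l p) *\<^sub>R d p = of_int m *\<^sub>R (2 *\<^sub>R d p)" by simp
    then show ?thesis using double_d[OF that] by (simp only: BW16_closed Ints_of_int)
  qed
  then have "(\<Sum>p<8. of_int (k p - l p) *\<^sub>R d p) \<in> BW16"
    unfolding BW16_eq by (intro zmodule.span_sum) auto
  then show ?thesis
    by (simp add: glue_sum_def sum_subtractf scaleR_diff_left)
qed

lemma in_dual_glue_sum: "in_dual (glue_sum k)"
  using in_dual_d by (auto simp: in_dual_def glue_sum_def inner_sum_left intro!: Ints_sum Ints_mult)

lemma inner_glue_sum_d:
  assumes "q < 8"
  shows "glue_sum k \<bullet> d q - of_int (k (partner q)) / 2 \<in> \<int>"
proof -
  have "of_int (k (partner q)) / 2 = (\<Sum>p<8. of_int (k p) * (of_bool (q = partner p) / 2 :: real))"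
  proof -
    have "q = partner p \<longleftrightarrow> p = partner q" if "p < 8" for p
      using that assms by (metis partner_partner)
    then have "(\<Sum>p<8. of_int (k p) * (of_bool (q = partner p) / 2 :: real)) =
        (\<Sum>p<8. if p = partner q then of_int (k p) / 2 else 0)"
      by (intro sum.cong) auto
    then show ?thesis by simp
  qed
  then have "glue_sum k \<bullet> d q - of_int (k (partner q)) / 2 =
      (\<Sum>p<8. of_int (k p) * (d p \<bullet> d q - of_bool (q = partner p) / 2))"
    by (simp add: glue_sum_def inner_sum_left sum_subtractf right_diff_distrib)
  also have "\<dots> \<in> \<int>"
    using assms by (intro Ints_sum Ints_mult inner_d_d) auto
  finally show ?thesis .
qed

definition rep :: "bool list \<Rightarrow> real ^ 16" where
  "rep c = glue_sum (\<lambda>p. of_bool (c ! p))"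

lemma inner_rep_d: "q < 8 \<Longrightarrow> rep c \<bullet> d q - of_bool (c ! partner q) / 2 \<in> \<int>"
  using inner_glue_sum_d[of q "\<lambda>p. of_bool (c ! p)"] by (simp add: rep_def)

lemma in_dual_diff: "in_dual x \<Longrightarrow> in_dual y \<Longrightarrow> in_dual (x - y)"
  by (auto simp: in_dual_def inner_diff_left)

text \<open>Coordinate \<open>p\<close> is read off by pairing with the dual basis vector
  \<open>d (partner p)\<close>. The difference then pairs integrally with \<open>BW16\<close> and
  with all glue vectors, and biduality puts it into \<open>BW16\<close>.\<close>

lemma obtain_rep:
  assumes "in_dual y"
  obtains c where "length c = 8" "y - rep c \<in> BW16"
proof
  let ?c = "map (\<lambda>p. odd \<lfloor>2 * (y \<bullet> d (partner p))\<rfloor>) [0..<8]"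
  show "length ?c = 8" by simp
  show "y - rep ?c \<in> BW16"
  proof (rule mem_BW16I)
    show "(y - rep ?c) \<bullet> b \<in> \<int>" if "b \<in> BW16" for b
      using in_dual_diff[OF assms in_dual_glue_sum] that by (simp add: in_dual_def rep_def)
    fix e assume "e \<in> set glue"
    then obtain q where q: "q < 8" "e = glue ! q"
      using length_coords(4) by (metis in_set_conv_nth)
    have "2 * (y \<bullet> d q) \<in> \<int>"
      using assms double_d[OF q(1)] by (force simp: in_dual_def)
    then obtain n where n: "2 * (y \<bullet> d q) = of_int n"
      by (auto elim: Ints_cases)
    have c: "?c ! partner q = odd n"
      using q(1) n by (simp del: upt.simps upt_rec_numeral)
    have "y \<bullet> d q - of_bool (?c ! partner q) / 2 = of_int (n div 2)"
      unfolding c using n by (cases "even n") (auto elim!: evenE oddE simp: field_simps)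
    then have "y \<bullet> d q - of_bool (?c ! partner q) / 2 \<in> \<int>"
      by (simp only: Ints_of_int)
    then have "(y \<bullet> d q - of_bool (?c ! partner q) / 2) - (rep ?c \<bullet> d q - of_bool (?c ! partner q) / 2) \<in> \<int>"
      using inner_rep_d[OF q(1)] by (rule Ints_diff)
    then show "(y - rep ?c) \<bullet> half_vec e \<in> \<int>"
      by (simp add: q(2) inner_diff_left)
  qed
qed

text \<open>The Siegel transformation of the classes of \<open>d p\<close> and \<open>d q\<close>, in coordinates. It is used
  only if \<open>q\<close> is neither \<open>p\<close> nor the partner of \<open>p\<close>.\<close>

definition siegel :: "nat \<Rightarrow> nat \<Rightarrow> bool list \<Rightarrow> bool list" where
  "siegel p q c = c[p := (c ! p \<noteq> c ! partner q), q := (c ! q \<noteq> c ! partner p)]"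

text \<open>Each pair contains exactly one of 3 and 7, so the hyperbolic plane of \<open>d 3\<close>
  and \<open>d 7\<close> is the hub through which coordinates are exchanged. The first entry is the
  class of the frame, the second that of its half-sum.\<close>

definition moves :: "(nat \<times> nat) list" where
  "moves = concat (map (\<lambda>i. [(i, 3), (i, 7), (3, 4 + i), (7, 4 + i)]) [0..<3])"

text \<open>With the coordinates numbered by \<open>x \<in> {0..<16}\<close>, read as a vector of bits, the class \<open>p < 4\<close> contains
  \<open>\<plusminus>e\<^sub>x \<plusminus> e\<^sub>y\<close> whenever \<open>x\<close> and \<open>y\<close> differ in bit \<open>p\<close> only, and the class \<open>4 + i\<close> contains \<open>half i\<close>.\<close>

definition frame_coords :: "nat \<Rightarrow> nat \<Rightarrow> int list list" where
  "frame_coords p q =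
    (if p < 3 \<and> q = 3 then
       concat (map (\<lambda>y. map (\<lambda>s. signed (\<lambda>x. 2 * of_bool (x = y) + 2 * s * of_bool (x = y + 2 ^ p))) [1, - 1]) [0, 8])
     else if p < 3 then
       map (\<lambda>y. signed (\<lambda>x. 2 * of_bool (x = y \<or> x = y + 2 ^ p))) (filter (\<lambda>y. even (y div 2 ^ p)) [0..<8])
     else if p = 3 then
       map (\<lambda>y. signed (\<lambda>x. 2 * of_bool (x = y \<or> x = y + 8))) (filter (\<lambda>y. even (y div 2 ^ (q - 4))) [0..<8])
     else
       concat (map (\<lambda>h. map (\<lambda>s. signed (\<lambda>x. of_bool (x div 8 = h) * (if even (x div 2 ^ (q - 4)) then 1 else s))) [1, - 1]) [0, 1]))"

text \<open>The number 8 is norm 2 in doubled coordinates. The division by 2 is checked to be exact,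
  and both classes are tested with \<open>in_bw\<close>.\<close>

definition is_frame :: "nat \<Rightarrow> nat \<Rightarrow> int list list \<Rightarrow> bool" where
  "is_frame p q rs \<longleftrightarrow> p < 8 \<and> q < 8 \<and> p \<noteq> q \<and> length rs = 4 \<and>
    (\<forall>i\<in>set [0..<4]. \<forall>j\<in>set [0..<4]. dot (rs ! i) (rs ! j) = (if i = j then 8 else 0)) \<and>
    (\<forall>r\<in>set rs. length r = 16 \<and> in_bw (lincomb [(1, r), (- 1, glue ! p)])) \<and>
    (let t = lincomb (map (Pair 1) rs); s = map (\<lambda>x. x div 2) t in
      map ((*) 2) s = t \<and> in_bw (lincomb [(1, s), (- 1, glue ! q)]))"

text \<open>The half-sums are visible. For (i, 3) only the positions 0 and 8 survive; for (i, 7) the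
  pairs tile the first eight positions; for (3, 4 + i) they tile the hyperplane where bit i
  vanishes; for (7, 4 + i) the opposite signs cancel off that hyperplane.\<close>

lemma is_frame_frame_coords: "\<forall>(p, q)\<in>set moves. is_frame p q (frame_coords p q)"
  by code_simp

lemma frame_coordsE:
  assumes "(p, q) \<in> set moves"
  obtains r1 r2 r3 r4 where "frame r1 r2 r3 r4"
    "r1 - d p \<in> BW16" "r2 - d p \<in> BW16" "r3 - d p \<in> BW16" "r4 - d p \<in> BW16"
    "(1/2) *\<^sub>R (r1 + r2 + r3 + r4) - d q \<in> BW16"
proof -
  have fr: "is_frame p q (frame_coords p q)"
    using is_frame_frame_coords assms by blast
  then obtain r1 r2 r3 r4 where rs: "frame_coords p q = [r1, r2, r3, r4]"
    by (auto simp: is_frame_def numeral_eq_Suc length_Suc_conv)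
  have len: "length (glue ! p) = 16" "length (glue ! q) = 16"
    using fr length_coords(2,4) by (auto simp: is_frame_def)
  define s where "s = map (\<lambda>x. x div 2) (lincomb (map (Pair 1) [r1, r2, r3, r4]))"
  have len_r: "\<forall>r\<in>{r1, r2, r3, r4}. length r = 16"
    using fr by (simp add: is_frame_def rs)
  then have len_t: "length (lincomb (map (Pair 1) [r1, r2, r3, r4])) = 16"
    by (intro length_lincomb) auto
  then have len_s: "length s = 16" by (simp add: s_def)
  have diff: "half_vec v - half_vec w \<in> BW16"
    if "in_bw (lincomb [(1, v), (- 1, w)])" "length v = 16" "length w = 16" for v w
    using mem_BW16_if_in_bw[OF that(1)] that(2,3) by (simp add: half_vec_lincomb)
  show thesis
  proof (rule that[of "half_vec r1" "half_vec r2" "half_vec r3" "half_vec r4"])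
    have "\<forall>i\<in>{0,1,2,3}. \<forall>j\<in>{0,1,2,3}. dot ([r1, r2, r3, r4] ! i) ([r1, r2, r3, r4] ! j) = (if i = j then 8 else 0)"
    proof -
      have "set [0..<4] = {0,1,2,3::nat}" by auto
      then show ?thesis using fr unfolding is_frame_def rs by metis
    qed
    then show "frame (half_vec r1) (half_vec r2) (half_vec r3) (half_vec r4)"
      using len_r by (simp add: frame_def inner_half_vec)
    show "half_vec r1 - d p \<in> BW16" "half_vec r2 - d p \<in> BW16" "half_vec r3 - d p \<in> BW16" "half_vec r4 - d p \<in> BW16"
      using fr len len_r by (auto simp: is_frame_def rs intro!: diff)
    have "half_vec s - d q \<in> BW16"
      using fr len len_s by (intro diff) (auto simp: is_frame_def rs s_def Let_def)
    moreover have "half_vec s = (1/2) *\<^sub>R (half_vec r1 + half_vec r2 + half_vec r3 + half_vec r4)"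
    proof -
      have "map ((*) 2) s = lincomb (map (Pair 1) [r1, r2, r3, r4])"
        using fr unfolding is_frame_def rs s_def Let_def by blast
      then have "2 *\<^sub>R half_vec s = half_vec (lincomb (map (Pair 1) [r1, r2, r3, r4]))"
        using half_vec_double[OF len_s] by simp
      also have "\<dots> = half_vec r1 + half_vec r2 + half_vec r3 + half_vec r4"
        using len_r by (subst half_vec_lincomb) (auto simp: add.assoc)
      finally have double: "2 *\<^sub>R half_vec s = half_vec r1 + half_vec r2 + half_vec r3 + half_vec r4" .
      show ?thesis unfolding double[symmetric] by simp
    qed
    ultimately show "(1/2) *\<^sub>R (half_vec r1 + half_vec r2 + half_vec r3 + half_vec r4) - d q \<in> BW16"
      by simp
  qed
qed

section \<open>Action of the moves on overlattices\<close>

definition overlattice :: "(real ^ 16) set \<Rightarrow> bool" where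
  "overlattice M \<longleftrightarrow> zmodule.subspace M \<and> BW16 \<subseteq> M \<and> (\<forall>x\<in>M. \<forall>y\<in>M. x \<bullet> y \<in> \<int>)"

lemma overlattice_cong:
  assumes "overlattice M" "x \<in> M" "x - y \<in> BW16"
  shows "y \<in> M"
proof -
  have "zmodule.subspace M" "x - y \<in> M"
    using assms by (auto simp: overlattice_def)
  from zmodule.subspace_diff[OF this(1) assms(2) this(2)] show ?thesis by simp
qed

lemma in_dual_if_overlattice: "overlattice M \<Longrightarrow> x \<in> M \<Longrightarrow> in_dual x"
  by (auto simp: overlattice_def in_dual_def)

text \<open>Twice the product of \<open>rep c\<close> with \<open>d q\<close> is an integer with the
  parity of coordinate \<open>partner q\<close>. So both vectors have the same coefficients modulo
  2, where subtraction is addition.\<close>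

lemma rep_siegel:
  assumes "p < 8" "q < 8" "p \<noteq> q" "length c = 8"
  shows "rep (siegel p q c) - (rep c - (2 * (rep c \<bullet> d q)) *\<^sub>R d p - (2 * (rep c \<bullet> d p)) *\<^sub>R d q) \<in> BW16"
proof -
  obtain m n where
    m: "rep c \<bullet> d q - of_bool (c ! partner q) / 2 = of_int m" and
    n: "rep c \<bullet> d p - of_bool (c ! partner p) / 2 = of_int n"
    using inner_rep_d[OF assms(1), of c] inner_rep_d[OF assms(2), of c] by (metis Ints_cases)
  define k l :: "nat \<Rightarrow> int" where
    "k = (\<lambda>i. of_bool (siegel p q c ! i))" and
    "l = (\<lambda>i. of_bool (c ! i) - (if i = p then 2 * m + of_bool (c ! partner q) else 0) -
       (if i = q then 2 * n + of_bool (c ! partner p) else 0))"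
  have "glue_sum k - glue_sum l \<in> BW16"
    using assms by (intro glue_sum_cong) (auto simp: k_def l_def siegel_def nth_list_update)
  moreover have "glue_sum k = rep (siegel p q c)"
    by (simp add: k_def rep_def)
  moreover have "glue_sum l = rep c - (2 * (rep c \<bullet> d q)) *\<^sub>R d p - (2 * (rep c \<bullet> d p)) *\<^sub>R d q"
  proof -
    have "2 * (rep c \<bullet> d q) = of_int (2 * m + of_bool (c ! partner q))"
      "2 * (rep c \<bullet> d p) = of_int (2 * n + of_bool (c ! partner p))"
      using m n by simp_all
    moreover have "glue_sum l = rep c - of_int (2 * m + of_bool (c ! partner q)) *\<^sub>R d p -
      of_int (2 * n + of_bool (c ! partner p)) *\<^sub>R d q"
      using assms
      by (simp add: glue_sum_def l_def rep_def scaleR_diff_left sum_subtractf if_distrib[of of_int]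
          if_distribR sum.delta if_distrib[of "\<lambda>x. x *\<^sub>R _"] cong: if_cong del: of_int_add of_int_mult)
    ultimately show ?thesis by simp
  qed
  ultimately show ?thesis by simp
qed

text \<open>On \<open>BW16\<close> the products with \<open>d p\<close> and \<open>d q\<close> are
  integers, so the Siegel terms are integral multiples of \<open>2 *\<^sub>R d p\<close> and
  \<open>2 *\<^sub>R d q\<close>.\<close>

lemma reflect_BW16:
  assumes x: "x \<in> BW16" and pq: "p < 8" "q < 8"
    and r: "r1 - d p \<in> BW16" "r2 - d p \<in> BW16" "r3 - d p \<in> BW16" "r4 - d p \<in> BW16"
    "(1/2) *\<^sub>R (r1 + r2 + r3 + r4) - d q \<in> BW16"
  shows "reflect r1 r2 r3 r4 x \<in> BW16"
proof -
  have "x \<bullet> d q \<in> \<int>" "x \<bullet> d p \<in> \<int>"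
    using x pq in_dual_d by (auto simp: in_dual_def inner_commute)
  then have "(x \<bullet> d q) *\<^sub>R (2 *\<^sub>R d p) \<in> BW16" "(x \<bullet> d p) *\<^sub>R (2 *\<^sub>R d q) \<in> BW16"
    using pq by (auto intro!: BW16_closed double_d simp del: scaleR_scaleR)
  then have "x - (2 * (x \<bullet> d q)) *\<^sub>R d p - (2 * (x \<bullet> d p)) *\<^sub>R d q \<in> BW16"
    using x by (auto intro!: BW16_closed simp: mult.commute)
  then have "x - (2 * (x \<bullet> d q)) *\<^sub>R d p - (2 * (x \<bullet> d p)) *\<^sub>R d q -
    (x - (2 * (x \<bullet> d q)) *\<^sub>R d p - (2 * (x \<bullet> d p)) *\<^sub>R d q - reflect r1 r2 r3 r4 x) \<in> BW16"
    using reflect_dual[OF BW16_in_dual[OF x] r double_d[OF pq(1)]] by (rule BW16_closed)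
  then show ?thesis by simp
qed

text \<open>One \<open>M'\<close> serves all classes \<open>c\<close>, so that the flag vectors
  already reached are tracked together with the vector being moved.\<close>

lemma move:
  assumes "(p, q) \<in> set moves" and M: "overlattice M"
  shows "\<exists>M'. overlattice M' \<and> isometric M M' \<and>
    (\<forall>c. length c = 8 \<longrightarrow> rep c \<in> M \<longrightarrow> rep (siegel p q c) \<in> M')"
proof -
  obtain r1 r2 r3 r4 where fr: "frame r1 r2 r3 r4"
    and r: "r1 - d p \<in> BW16" "r2 - d p \<in> BW16" "r3 - d p \<in> BW16" "r4 - d p \<in> BW16"
      "(1/2) *\<^sub>R (r1 + r2 + r3 + r4) - d q \<in> BW16"
    using frame_coordsE[OF assms(1)] by blast
  have pq: "p < 8" "q < 8" "p \<noteq> q"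
    using is_frame_frame_coords assms(1) by (auto simp: is_frame_def)
  define h where "h = reflect r1 r2 r3 r4"
  have h: "linear h" "h (h x) = x" "h x \<bullet> h y = x \<bullet> y" "x \<in> BW16 \<Longrightarrow> h x \<in> BW16" for x y
    using linear_reflect reflect_reflect[OF fr] inner_reflect[OF fr] reflect_BW16[OF _ pq(1,2) r]
    by (auto simp: h_def)
  have M': "overlattice (h ` M)"
    unfolding overlattice_def
  proof (intro conjI)
    have sub: "zmodule.subspace M" using M by (simp add: overlattice_def)
    show "zmodule.subspace (h ` M)"
    proof (rule zmodule.subspaceI)
      show "0 \<in> h ` M"
        using sub linear_0[OF h(1)] by (metis image_eqI zmodule.subspace_0)
      fix x y :: "real ^ 16" and k :: int
      assume x: "x \<in> h ` M"
      then obtain a where a: "a \<in> M" "x = h a" by blast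
      show "of_int k *\<^sub>R x \<in> h ` M"
        unfolding a(2) linear_scale[OF h(1), symmetric]
        by (intro imageI zmodule.subspace_scale[OF sub] a(1))
      assume "y \<in> h ` M"
      then obtain b where b: "b \<in> M" "y = h b" by blast
      show "x + y \<in> h ` M"
        unfolding a(2) b(2) linear_add[OF h(1), symmetric]
        by (intro imageI zmodule.subspace_add[OF sub] a(1) b(1))
    qed
    show "BW16 \<subseteq> h ` M"
    proof
      fix x assume "x \<in> BW16"
      \<comment> \<open>As \<open>h\<close> is an involution, preserving \<open>BW16\<close> is
        enough to have \<open>BW16\<close> inside the image of \<open>M\<close>.\<close>
      then have "h x \<in> M" using h(4) M by (auto simp: overlattice_def)
      then show "x \<in> h ` M" using h(2) by (metis image_eqI)
    qed
    show "\<forall>x\<in>h ` M. \<forall>y\<in>h ` M. x \<bullet> y \<in> \<int>"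
      using M h(3) by (auto simp: overlattice_def)
  qed
  moreover have "isometric M (h ` M)"
    using orthogonal_transformation_reflect[OF fr] by (auto simp: isometric_def h_def)
  moreover have "rep (siegel p q c) \<in> h ` M" if c: "length c = 8" "rep c \<in> M" for c
  proof -
    let ?z = "rep c - (2 * (rep c \<bullet> d q)) *\<^sub>R d p - (2 * (rep c \<bullet> d p)) *\<^sub>R d q"
    have "?z - h (rep c) \<in> BW16"
      unfolding h_def by (intro reflect_dual in_dual_if_overlattice[OF M c(2)] r double_d pq)
    with rep_siegel[OF pq c(1)] have "(rep (siegel p q c) - ?z) + (?z - h (rep c)) \<in> BW16"
      by (rule BW16_closed)
    then have "rep (siegel p q c) - h (rep c) \<in> BW16" by simp
    from BW16_closed(4)[OF this] have "h (rep c) - rep (siegel p q c) \<in> BW16" by simp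
    then show ?thesis
      using overlattice_cong[OF M'] c(2) by blast
  qed
  ultimately show ?thesis by blast
qed

lemma isometric_refl: "isometric M M"
  unfolding isometric_def by (intro exI[of _ id]) (simp add: orthogonal_transformation_id[unfolded id_def[symmetric]])

lemma isometric_trans:
  assumes "isometric L M" "isometric M N" shows "isometric L N"
  using assms unfolding isometric_def
  by (metis image_comp orthogonal_transformation_compose)

lemma length_siegel [simp]: "length (siegel p q c) = length c"
  by (simp add: siegel_def)

definition act :: "(nat \<times> nat) list \<Rightarrow> bool list \<Rightarrow> bool list" where
  "act = fold (\<lambda>(p, q). siegel p q)"

lemma act_overlattice:
  assumes "set w \<subseteq> set moves" and M: "overlattice M"
  shows "\<exists>M'. overlattice M' \<and> isometric M M' \<and> (\<forall>c. length c = 8 \<longrightarrow> rep c \<in> M \<longrightarrow> rep (act w c) \<in> M')"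
  using assms
proof (induction w arbitrary: M)
  case Nil
  then show ?case using isometric_refl by (auto simp: act_def)
next
  case (Cons m w)
  obtain p q where m: "m = (p, q)" by fastforce
  obtain M1 where M1: "overlattice M1" "isometric M M1"
      "\<And>c. length c = 8 \<Longrightarrow> rep c \<in> M \<Longrightarrow> rep (siegel p q c) \<in> M1"
    using move[of p q M] Cons.prems m by auto
  obtain M2 where M2: "overlattice M2" "isometric M1 M2"
      "\<And>c. length c = 8 \<Longrightarrow> rep c \<in> M1 \<Longrightarrow> rep (act w c) \<in> M2"
    using Cons.IH[OF _ M1(1)] Cons.prems by auto
  show ?case
    using M1 M2 isometric_trans by (intro exI[of _ M2]) (auto simp: m act_def)
qed

section \<open>Orbits of singular and nonsingular vectors\<close>

definition unit :: "nat \<Rightarrow> bool list" where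
  "unit i = (replicate 8 False)[i := True]"

text \<open>\<open>True\<close> if the norm of \<open>rep c\<close> is odd.\<close>

definition quad :: "bool list \<Rightarrow> bool" where
  "quad c = ((c ! 0 \<and> c ! 4) \<noteq> ((c ! 1 \<and> c ! 5) \<noteq> ((c ! 2 \<and> c ! 6) \<noteq> (c ! 3 \<and> c ! 7))))"

text \<open>The class of \<open>f\<^sub>1\<close>.\<close>

definition nonsing :: "bool list" where
  "nonsing = [False, False, False, True, False, False, False, True]"

primrec holds :: "bool list \<Rightarrow> (nat \<times> bool) list \<Rightarrow> bool" where
  "holds c [] = True"
| "holds c (x # g) = (c ! fst x = snd x \<and> holds c g)"

text \<open>Guarded moves: one short program treats every class, each class selecting its own
  subsequence.\<close>

fun run :: "((nat \<times> bool) list \<times> nat \<times> nat) list \<Rightarrow> bool list \<Rightarrow> bool list" where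
  "run [] c = c"
| "run ((g, p, q) # prog) c =
     run prog (if holds c g then siegel p q c else c)"

text \<open>The coordinates 4 to 7 are first reduced to coordinate 7 alone, which then clears coordinates
  0 to 2. The nonsingular vectors end up as \<open>nonsing\<close>. A singular vector is moved to the span of the
  first four basis vectors and there, through coordinate 3, to \<open>unit j\<close>.\<close>

definition prog_reduce :: "nat \<Rightarrow> ((nat \<times> bool) list \<times> nat \<times> nat) list" where
  "prog_reduce j =
     map (\<lambda>i. ([(4 + i, True), (7, False)], (i, 7))) [j..<3] @
     map (\<lambda>i. ([(4 + i, True)], (3, 4 + i))) [j..<3] @
     map (\<lambda>i. ([(i, True), (7, True)], (i, 3))) [0..<3]"

definition prog_singular :: "nat \<Rightarrow> ((nat \<times> bool) list \<times> nat \<times> nat) list" where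
  "prog_singular j =
     prog_reduce j @ [([(7, True)], (j, 3)), ([(7, True)], (7, 4 + j))] @
     map (\<lambda>i. ([(i, True), (3, False)], (3, 4 + i))) [j..<3] @
     map (\<lambda>i. ([(i, True), (3, True)], (i, 7))) [0..<3] @
     [([], (j, 7)), ([], (3, 4 + j))]"

text \<open>Vanishing of coordinate 4 + i is orthogonality to \<open>unit i\<close>; a coordinate
  set at \<open>j\<close> or later means lying outside the span of the first \<open>j\<close> flag
  vectors.\<close>

definition singular_classes :: "nat \<Rightarrow> bool list list" where
  "singular_classes j = filter (\<lambda>c. \<not> quad c \<and> list_all (\<lambda>i. \<not> c ! (4 + i)) [0..<j] \<and>
     list_ex (\<lambda>k. c ! k) [j..<8]) (List.n_lists 8 [False, True])"

definition nonsingular_classes :: "nat \<Rightarrow> bool list list" where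
  "nonsingular_classes j = filter (\<lambda>c. quad c \<and> list_all (\<lambda>i. \<not> c ! (4 + i)) [0..<j])
     (List.n_lists 8 [False, True])"

text \<open>The word depends on \<open>c\<close>, but once \<open>c\<close> is chosen it is a fixed
  product of moves and can be applied to a whole lattice.\<close>

lemma run_eq_act: "\<exists>w. set w \<subseteq> snd ` set prog \<and> run prog c = act w c"
proof (induction prog arbitrary: c)
  case Nil
  show ?case by (intro exI[of _ "[]"]) (simp add: act_def)
next
  case (Cons m prog)
  obtain g p q where m: "m = (g, p, q)" by (cases m)
  show ?case
  proof (cases "holds c g")
    case True
    obtain w where "set w \<subseteq> snd ` set prog" "run prog (siegel p q c) = act w (siegel p q c)"
      using Cons.IH by blast
    then show ?thesis
      using True by (intro exI[of _ "(p, q) # w"]) (auto simp: m act_def)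
  next
    case False
    obtain w where "set w \<subseteq> snd ` set prog" "run prog c = act w c"
      using Cons.IH by blast
    then show ?thesis
      using False by (intro exI[of _ w]) (auto simp: m)
  qed
qed

text \<open>Only moves involving 4 + i can change \<open>unit i\<close>, and the programs use these
  for i \<ge> j alone. The moves (i, 3) and (i, 7) fix the whole flag, so their ranges may start at
  0.\<close>

lemma prog_moves:
  "list_all (\<lambda>j. list_all (\<lambda>(g, p, q). (p, q) \<in> set moves \<and>
     list_all (\<lambda>i. siegel p q (unit i) = unit i) [0..<j]) (prog_singular j)) [0..<3]"
  by code_simp

text \<open>If coordinate 7 is set after the reduction, \<open>quad\<close> equals coordinate 3, so
  the class is \<open>unit 7\<close>; the two moves guarded by coordinate 7 turn it into
  \<open>unit j\<close>.\<close>

lemma run_prog_singular: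
  "list_all ((=) (unit 0)) (map (run (prog_singular 0)) (singular_classes 0))"
  "list_all ((=) (unit 1)) (map (run (prog_singular 1)) (singular_classes 1))"
  "list_all ((=) (unit 2)) (map (run (prog_singular 2)) (singular_classes 2))"
  by code_simp+

text \<open>After the reduction \<open>quad\<close> is the product of coordinates 3 and 7, so for a
  nonsingular class both are set and all others are cleared.\<close>

lemma run_prog_reduce:
  "list_all ((=) nonsing) (map (run (prog_reduce 0)) (nonsingular_classes 0))"
  "list_all ((=) nonsing) (map (run (prog_reduce 1)) (nonsingular_classes 1))"
  "list_all ((=) nonsing) (map (run (prog_reduce 2)) (nonsingular_classes 2))"
  by code_simp+

section \<open>Classes occurring in an overlattice\<close>

lemma quad_add_nonsing:
  assumes "length c = 8" "quad c" "c ! 3 = c ! 7"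
  shows "\<not> quad (map2 (\<noteq>) c nonsing)"
  using assms by (cases "c ! 7") (simp_all add: quad_def nonsing_def)

lemma length_unit [simp]: "length (unit i) = 8" by (simp add: unit_def)

text \<open>Splits off the hyperbolic plane of \<open>d 3\<close> and \<open>d 7\<close>, where the
  final case distinctions take place.\<close>

lemma rep_split:
  assumes "length c = 8"
  shows "rep c = rep (c[3 := False, 7 := False]) + of_bool (c ! 3) *\<^sub>R d 3 + of_bool (c ! 7) *\<^sub>R d 7"
  using assms
  by (simp add: rep_def glue_sum_def lessThan_nat_numeral nth_list_update)

lemma rep_mem:
  assumes "zmodule.subspace N" "\<And>p. p < 8 \<Longrightarrow> c ! p \<Longrightarrow> d p \<in> N"
  shows "rep c \<in> N"
  unfolding rep_def glue_sum_def
proof (rule zmodule.subspace_sum[OF assms(1)])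
  fix p :: nat assume "p \<in> {..<8}"
  then show "of_int (of_bool (c ! p)) *\<^sub>R d p \<in> N"
    using assms(2)[of p] zmodule.subspace_0[OF assms(1)] by (cases "c ! p") auto
qed

lemma rep_unit:
  assumes "i < 8"
  shows "rep (unit i) = d i"
proof -
  have "rep (unit i) = (\<Sum>p<8. if p = i then d p else 0)"
    unfolding rep_def glue_sum_def by (intro sum.cong) (auto simp: unit_def nth_list_update)
  then show ?thesis using assms by simp
qed

lemma rep_nonsing: "rep nonsing = d 3 + d 7"
  by (simp add: rep_def glue_sum_def nonsing_def lessThan_nat_numeral)

lemma half_notin_Ints: "1 / 2 \<notin> (\<int> :: real set)"
  using of_int_div_of_int_in_Ints_iff[where 'a = real, of 1 2] by simp

text \<open>Otherwise the product with \<open>d q\<close> would be a half-integer.\<close>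

lemma not_nth_if_d_mem:
  assumes "overlattice M" "rep c \<in> M" "d q \<in> M" "q < 8"
  shows "\<not> c ! partner q"
proof
  assume "c ! partner q"
  then have "rep c \<bullet> d q - 1 / 2 \<in> \<int>"
    using inner_rep_d[OF assms(4), of c] by simp
  moreover have "rep c \<bullet> d q \<in> \<int>"
    using assms by (auto simp: overlattice_def)
  ultimately have "rep c \<bullet> d q - (rep c \<bullet> d q - 1 / 2) \<in> \<int>"
    by (rule Ints_diff[rotated])
  moreover have "rep c \<bullet> d q - (rep c \<bullet> d q - 1 / 2) = 1 / 2" by simp
  ultimately show False using half_notin_Ints by metis
qed

lemma nth_3_eq_nth_7:
  assumes "overlattice M" "rep c \<in> M" "d 3 + d 7 \<in> M"
  shows "c ! 3 = c ! 7"
proof (rule ccontr)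
  assume "c ! 3 \<noteq> c ! 7"
  have "rep c \<bullet> d 3 - of_bool (c ! 7) / 2 \<in> \<int>" "rep c \<bullet> d 7 - of_bool (c ! 3) / 2 \<in> \<int>"
    using inner_rep_d[of 3 c] inner_rep_d[of 7 c] by (simp_all add: partner_def)
  then have "(rep c \<bullet> d 3 - of_bool (c ! 7) / 2) + (rep c \<bullet> d 7 - of_bool (c ! 3) / 2) \<in> \<int>"
    by (rule Ints_add)
  moreover have "rep c \<bullet> (d 3 + d 7) \<in> \<int>"
    using assms by (auto simp: overlattice_def)
  ultimately have "rep c \<bullet> (d 3 + d 7) -
      ((rep c \<bullet> d 3 - of_bool (c ! 7) / 2) + (rep c \<bullet> d 7 - of_bool (c ! 3) / 2)) \<in> \<int>"
    by (intro Ints_diff)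
  moreover have "rep c \<bullet> (d 3 + d 7) -
      ((rep c \<bullet> d 3 - of_bool (c ! 7) / 2) + (rep c \<bullet> d 7 - of_bool (c ! 3) / 2)) = 1 / 2"
    using \<open>c ! 3 \<noteq> c ! 7\<close> by (cases "c ! 3") (simp_all add: inner_add_right)
  ultimately show False using half_notin_Ints by simp
qed

lemma rep_add_mem:
  assumes "overlattice M" "rep c \<in> M" "rep c' \<in> M" "length c = 8" "length c' = 8"
  shows "rep (map2 (\<noteq>) c c') \<in> M"
proof (rule overlattice_cong[OF assms(1)])
  show "rep c + rep c' \<in> M"
    using assms by (auto simp: overlattice_def intro: zmodule.subspace_add)
  have "glue_sum (\<lambda>p. of_bool (c ! p) + of_bool (c' ! p)) - glue_sum (\<lambda>p. of_bool (map2 (\<noteq>) c c' ! p)) \<in> BW16"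
    using assms by (intro glue_sum_cong) auto
  then show "rep c + rep c' - rep (map2 (\<noteq>) c c') \<in> BW16"
    by (simp add: rep_def glue_sum_def scaleR_add_left sum.distrib)
qed

lemma mem_n_lists: "length c = 8 \<Longrightarrow> c \<in> set (List.n_lists 8 [False, True])"
  by (auto simp: set_n_lists)

text \<open>Allowing any \<open>prog\<close> built from steps of \<open>prog_singular j\<close>
  covers \<open>prog_reduce j\<close> as well.\<close>

lemma run_overlattice:
  assumes M: "overlattice M" "\<And>i. i < j \<Longrightarrow> d i \<in> M" and c: "length c = 8" "rep c \<in> M"
    and j: "j < 3" and prog: "set prog \<subseteq> set (prog_singular j)"
  shows "\<exists>M'. overlattice M' \<and> isometric M M' \<and> (\<forall>i<j. d i \<in> M') \<and> rep (run prog c) \<in> M'"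
proof -
  obtain w where w: "set w \<subseteq> snd ` set prog" "run prog c = act w c"
    using run_eq_act by blast
  have moves: "(p, q) \<in> set moves \<and> (\<forall>i<j. siegel p q (unit i) = unit i)" if pq: "(p, q) \<in> set w" for p q
  proof -
    obtain g where "(g, p, q) \<in> set (prog_singular j)"
      using w(1) prog pq by fastforce
    moreover have "j \<in> set [0..<3]" using j by simp
    ultimately show ?thesis
      using prog_moves unfolding list_all_iff by (fastforce simp only: set_upt atLeastLessThan_iff)
  qed
  then have "set w \<subseteq> set moves" by auto
  then obtain M' where M': "overlattice M'" "isometric M M'"
      "\<And>c. length c = 8 \<Longrightarrow> rep c \<in> M \<Longrightarrow> rep (act w c) \<in> M'"
    using act_overlattice[OF _ M(1)] by metis
  have "act w (unit i) = unit i" if "i < j" for i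
  proof -
    have "fold (\<lambda>(p, q). siegel p q) w (unit i) = unit i" if "\<forall>(p, q)\<in>set w. siegel p q (unit i) = unit i" for w
      using that by (induction w) auto
    then show ?thesis
      using moves that by (auto simp: act_def)
  qed
  then have "d i \<in> M'" if "i < j" for i
    using M'(3)[of "unit i"] M(2)[OF that] that j by (simp add: rep_unit)
  then show ?thesis
    using M' c w(2) by metis
qed

lemma singular_move:
  assumes M: "overlattice M" "\<And>i. i < j \<Longrightarrow> d i \<in> M" and c: "length c = 8" "rep c \<in> M"
    and j: "j < 3" and "\<not> quad c" and k: "j \<le> k" "k < 8" "c ! k"
  shows "\<exists>M'. overlattice M' \<and> isometric M M' \<and> (\<forall>i<Suc j. d i \<in> M')"
proof -
  have "\<not> c ! (4 + i)" if "i < j" for i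
    using not_nth_if_d_mem[OF M(1) c(2) M(2)[OF that]] that j by (simp add: partner_def add.commute)
  then have "c \<in> set (singular_classes j)"
    using mem_n_lists[OF c(1)] assms by (auto simp: singular_classes_def list_all_iff list_ex_iff)
  moreover have "j = 0 \<or> j = 1 \<or> j = 2" using j by linarith
  ultimately have run: "run (prog_singular j) c = unit j"
    using run_prog_singular unfolding list_all_iff set_map by (elim disjE) (metis imageI)+
  obtain M' where M': "overlattice M'" "isometric M M'" "\<forall>i<j. d i \<in> M'" "rep (run (prog_singular j) c) \<in> M'"
    using run_overlattice[OF M c j order_refl] by blast
  then have "d j \<in> M'" using run j by (simp add: rep_unit)
  with M' show ?thesis by (auto simp: less_Suc_eq)
qed

lemma nonsingular_move:
  assumes M: "overlattice M" "\<And>i. i < j \<Longrightarrow> d i \<in> M" and c: "length c = 8" "rep c \<in> M"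
    and j: "j < 3" and "quad c"
  shows "\<exists>M'. overlattice M' \<and> isometric M M' \<and> (\<forall>i<j. d i \<in> M') \<and> d 3 + d 7 \<in> M'"
proof -
  have "\<not> c ! (4 + i)" if "i < j" for i
    using not_nth_if_d_mem[OF M(1) c(2) M(2)[OF that]] that j by (simp add: partner_def add.commute)
  then have "c \<in> set (nonsingular_classes j)"
    using mem_n_lists[OF c(1)] assms by (auto simp: nonsingular_classes_def list_all_iff)
  moreover have "j = 0 \<or> j = 1 \<or> j = 2" using j by linarith
  ultimately have run: "run (prog_reduce j) c = nonsing"
    using run_prog_reduce unfolding list_all_iff set_map by (elim disjE) (metis imageI)+
  have "set (prog_reduce j) \<subseteq> set (prog_singular j)"
    unfolding prog_singular_def set_append by blast
  from run_overlattice[OF M c j this] show ?thesis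
    by (simp add: run rep_nonsing)
qed

section \<open>Standard positions\<close>

definition lat :: "(real ^ 16) set \<Rightarrow> (real ^ 16) set" where
  "lat D = zmodule.span (BW16 \<union> D)"

text \<open>An overlattice is a union of cosets of \<open>BW16\<close>, so comparing representatives
  suffices.\<close>

lemma overlattice_eq_lat:
  assumes M: "overlattice M" and D: "D \<subseteq> M"
    and rep: "\<And>c. length c = 8 \<Longrightarrow> rep c \<in> M \<Longrightarrow> rep c \<in> lat D"
  shows "M = lat D"
proof
  show "lat D \<subseteq> M"
    using M D unfolding lat_def overlattice_def by (intro zmodule.span_minimal) auto
  show "M \<subseteq> lat D"
  proof
    fix x assume x: "x \<in> M"
    obtain c where c: "length c = 8" "x - rep c \<in> BW16"
      using obtain_rep[OF in_dual_if_overlattice[OF M x]] .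
    then have "rep c \<in> lat D"
      using overlattice_cong[OF M x] rep by blast
    moreover have "x - rep c \<in> lat D"
      using c(2) unfolding lat_def by (simp add: zmodule.span_base)
    ultimately have "(x - rep c) + rep c \<in> lat D"
      unfolding lat_def by (intro zmodule.span_add)
    then show "x \<in> lat D" by simp
  qed
qed

lemma subspace_lat: "zmodule.subspace (lat D)"
  by (simp add: lat_def)

lemma lat_base: "x \<in> D \<Longrightarrow> x \<in> lat D"
  by (simp add: lat_def zmodule.span_base)

text \<open>Flag members; flag members with the nonsingular class added; and the maximal totally
  singular subspace through the first three flag vectors that belongs to the other family.\<close>

definition types :: "(real ^ 16) set set" where
  "types = {lat (d ` {..<j}) | j. j \<le> 4} \<union> {lat (insert (d 3 + d 7) (d ` {..<j})) | j. j \<le> 3} \<union>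
     {lat (insert (d 7) (d ` {..<3}))}"

text \<open>Coordinates 4 to 6 vanish by orthogonality, so \<open>M\<close> is determined by its
  part in the plane of \<open>d 3\<close> and \<open>d 7\<close>. An isotropic subspace of this
  plane has at most one nonzero class, which leaves the four cases.\<close>

lemma classify_if_3:
  assumes M: "overlattice M" and d: "\<And>i. i < 3 \<Longrightarrow> d i \<in> M"
  shows "M \<in> types"
proof -
  have sub: "zmodule.subspace M" using M by (simp add: overlattice_def)
  have perp: "\<not> c ! 4" "\<not> c ! 5" "\<not> c ! 6" if "rep c \<in> M" for c
    using not_nth_if_d_mem[OF M that d[of 0]] not_nth_if_d_mem[OF M that d[of 1]]
      not_nth_if_d_mem[OF M that d[of 2]] by (simp_all add: partner_def)
  have base: "rep (c[3 := False, 7 := False]) \<in> N"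
    if "length c = 8" "rep c \<in> M" "zmodule.subspace N" "\<And>i. i < 3 \<Longrightarrow> d i \<in> N" for c N
  proof (rule rep_mem[OF that(3)])
    fix p :: nat assume p: "p < 8" "c[3 := False, 7 := False] ! p"
    then have "p \<noteq> 3" "p \<noteq> 7" "c ! p"
      using that(1) by (auto simp: nth_list_update split: if_splits)
    then have "p \<noteq> 4" "p \<noteq> 5" "p \<noteq> 6"
      using perp[OF that(2)] by auto
    then have "p < 3" using \<open>p < 8\<close> \<open>p \<noteq> 3\<close> \<open>p \<noteq> 7\<close> by linarith
    then show "d p \<in> N" by (rule that(4))
  qed
  have dM: "d ` {..<3} \<subseteq> M" using d by auto
  have diff: "of_bool (c ! 3) *\<^sub>R d 3 + of_bool (c ! 7) *\<^sub>R d 7 \<in> M" if "length c = 8" "rep c \<in> M" for c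
    using zmodule.subspace_diff[OF sub that(2) base[OF that sub d]]
    by (simp add: rep_split[OF that(1)])
  have eq: "M = lat D"
    if "D \<subseteq> M" "d ` {..<3} \<subseteq> D" and
      "\<And>c. length c = 8 \<Longrightarrow> rep c \<in> M \<Longrightarrow> of_bool (c ! 3) *\<^sub>R d 3 + of_bool (c ! 7) *\<^sub>R d 7 \<in> lat D" for D
  proof (rule overlattice_eq_lat[OF M that(1)])
    fix c assume c: "length c = 8" "rep c \<in> M"
    have "rep (c[3 := False, 7 := False]) + (of_bool (c ! 3) *\<^sub>R d 3 + of_bool (c ! 7) *\<^sub>R d 7) \<in> lat D"
      using that(2) by (intro zmodule.subspace_add[OF subspace_lat] that(3) c base subspace_lat lat_base) auto
    then show "rep c \<in> lat D" by (simp only: rep_split[OF c(1)] add.assoc)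
  qed
  consider "\<forall>c. length c = 8 \<and> rep c \<in> M \<longrightarrow> \<not> c ! 3 \<and> \<not> c ! 7"
    | c where "length c = 8" "rep c \<in> M" "c ! 3" "\<not> c ! 7"
    | c where "length c = 8" "rep c \<in> M" "\<not> c ! 3" "c ! 7"
    | c where "length c = 8" "rep c \<in> M" "c ! 3" "c ! 7"
    by blast
  then show ?thesis
  proof cases
    case 1
    then have "M = lat (d ` {..<3})"
      using dM zmodule.subspace_0[OF subspace_lat] by (intro eq) auto
    then show ?thesis by (auto simp: types_def)
  next
    case 2
    then have d3: "d 3 \<in> M" using diff[of c] by simp
    have "\<not> c ! 7" if "rep c \<in> M" for c
      using not_nth_if_d_mem[OF M that d3] by (simp add: partner_def)
    moreover have less: "{..<4::nat} = insert 3 {..<3}" by auto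
    ultimately have "M = lat (d ` {..<4})"
      using dM d3 zmodule.subspace_0[OF subspace_lat] by (intro eq) (auto intro: lat_base)
    then show ?thesis by (auto simp: types_def)
  next
    case 3
    then have d7: "d 7 \<in> M" using diff[of c] by simp
    have "\<not> c ! 3" if "rep c \<in> M" for c
      using not_nth_if_d_mem[OF M that d7] by (simp add: partner_def)
    then have "M = lat (insert (d 7) (d ` {..<3}))"
      using dM d7 zmodule.subspace_0[OF subspace_lat] by (intro eq) (auto intro: lat_base)
    then show ?thesis by (auto simp: types_def)
  next
    case 4
    then have v: "d 3 + d 7 \<in> M" using diff[of c] by simp
    have "c ! 3 = c ! 7" if "rep c \<in> M" for c
      using nth_3_eq_nth_7[OF M that v] .
    then have "M = lat (insert (d 3 + d 7) (d ` {..<3}))"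
      using dM v zmodule.subspace_0[OF subspace_lat] by (intro eq) (auto intro: lat_base)
    then show ?thesis by (auto simp: types_def)
  qed
qed

lemma classify_step:
  assumes IH: "\<And>M. overlattice M \<Longrightarrow> (\<And>i. i < Suc j \<Longrightarrow> d i \<in> M) \<Longrightarrow> \<exists>N\<in>types. isometric M N"
    and j: "j < 3" and M: "overlattice M" "\<And>i. i < j \<Longrightarrow> d i \<in> M"
  shows "\<exists>N\<in>types. isometric M N"
proof -
  have sing: "\<exists>N\<in>types. isometric M N"
    if "overlattice M" "\<And>i. i < j \<Longrightarrow> d i \<in> M" "length c = 8" "rep c \<in> M" "\<not> quad c" "j \<le> k" "k < 8" "c ! k"
    for M c k
    using singular_move[OF that(1-4) j that(5-8)] IH isometric_trans by (metis (no_types))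
  have base: "rep c \<in> lat D"
    if "d ` {..<j} \<subseteq> D" "\<And>k. j \<le> k \<Longrightarrow> k < 8 \<Longrightarrow> \<not> c ! k" for c D
    using that by (intro rep_mem[OF subspace_lat] lat_base) (metis image_eqI lessThan_iff not_le subsetD)
  show ?thesis
  proof (cases "\<exists>c. length c = 8 \<and> rep c \<in> M \<and> quad c")
    case True
    then obtain c0 where c0: "length c0 = 8" "rep c0 \<in> M" "quad c0" by blast
    obtain M' where M': "overlattice M'" "isometric M M'" "\<And>i. i < j \<Longrightarrow> d i \<in> M'" "d 3 + d 7 \<in> M'"
      using nonsingular_move[OF M c0(1,2) j c0(3)] by blast
    have "\<exists>N\<in>types. isometric M' N"
    \<comment> \<open>If a singular class outside the flag survives, the normalisation of the
      nonsingular vector is given up and the flag is extended instead.\<close>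
    proof (cases "\<exists>c k. length c = 8 \<and> rep c \<in> M' \<and> \<not> quad c \<and> j \<le> k \<and> k < 8 \<and> c ! k")
      case True
      then show ?thesis using sing[OF M'(1,3)] by blast
    next
      case False
      have "M' = lat (insert (d 3 + d 7) (d ` {..<j}))"
      proof (rule overlattice_eq_lat[OF M'(1)])
        show "insert (d 3 + d 7) (d ` {..<j}) \<subseteq> M'" using M'(3,4) by auto
        fix c assume c: "length c = 8" "rep c \<in> M'"
        show "rep c \<in> lat (insert (d 3 + d 7) (d ` {..<j}))"
        proof (cases "quad c")
          case True
          have c37: "c ! 3 = c ! 7" using nth_3_eq_nth_7[OF M'(1) c(2) M'(4)] .
          \<comment> \<open>The sum of two nonsingular orthogonal classes is singular, hence in the
            span of the flag; so \<open>c\<close> agrees with \<open>nonsing\<close> from coordinate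
            \<open>j\<close> on.\<close>
          let ?c' = "map2 (\<noteq>) c nonsing"
          have len: "length nonsing = 8" by (simp add: nonsing_def)
          have "rep ?c' \<in> M'"
            using rep_add_mem[OF M'(1) c(2) _ c(1) len] M'(4) by (simp add: rep_nonsing)
          moreover have "\<not> quad ?c'" using quad_add_nonsing[OF c(1) True c37] .
          ultimately have c': "\<not> ?c' ! k" if "j \<le> k" "k < 8" for k
            using False that c(1) len by (metis length_map length_zip min.idem)
          then have "?c' ! 3 = False" "?c' ! 7 = False" using j by simp_all
          then have "c ! 3" "c ! 7" using c(1) by (simp_all add: nonsing_def)
          have "rep (c[3 := False, 7 := False]) \<in> lat (insert (d 3 + d 7) (d ` {..<j}))"
          proof (rule base)
            show "\<not> c[3 := False, 7 := False] ! k" if "j \<le> k" "k < 8" for k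
            proof (cases "k = 3 \<or> k = 7")
              case True
              then show ?thesis using c(1) by auto
            next
              case False
              have "\<forall>k<8. k \<noteq> 3 \<longrightarrow> k \<noteq> 7 \<longrightarrow> \<not> nonsing ! k"
                by (simp add: nonsing_def All_less_Suc numeral_eq_Suc)
              then show ?thesis using False c'[OF that] that c(1) len by simp
            qed
          qed auto
          from zmodule.subspace_add[OF subspace_lat this lat_base[of "d 3 + d 7"]]
          show ?thesis
            using \<open>c ! 3\<close> \<open>c ! 7\<close> by (simp add: rep_split[OF c(1)] add.assoc)
        next
          case nq: False
          then show ?thesis using False c by (intro base) auto
        qed
      qed
      then show ?thesis
        using j isometric_refl unfolding types_def by (intro bexI[of _ M']) auto
    qed
    then show ?thesis using M'(2) isometric_trans by blast
  next
    case nq: False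
    show ?thesis
    proof (cases "\<exists>c k. length c = 8 \<and> rep c \<in> M \<and> j \<le> k \<and> k < 8 \<and> c ! k")
      case True
      then show ?thesis using sing[OF M] nq by blast
    next
      case False
      then have "M = lat (d ` {..<j})"
        using M by (intro overlattice_eq_lat base) auto
      then show ?thesis
        using j isometric_refl unfolding types_def by (intro bexI[of _ M]) auto
    qed
  qed
qed

lemma classification:
  assumes "overlattice M"
  shows "\<exists>N\<in>types. isometric M N"
proof -
  have 3: "\<exists>N\<in>types. isometric M N" if "overlattice M" "\<And>i. i < 3 \<Longrightarrow> d i \<in> M" for M
    using classify_if_3[OF that] isometric_refl by blast
  have 2: "\<exists>N\<in>types. isometric M N" if "overlattice M" "\<And>i. i < 2 \<Longrightarrow> d i \<in> M" for M
    by (rule classify_step[of 2, OF _ _ that]) (use 3 in \<open>simp_all add: numeral_3_eq_3 numeral_2_eq_2\<close>)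
  have 1: "\<exists>N\<in>types. isometric M N" if "overlattice M" "\<And>i. i < 1 \<Longrightarrow> d i \<in> M" for M
    by (rule classify_step[of 1, OF _ _ that]) (use 2 in \<open>simp_all add: numeral_2_eq_2\<close>)
  show ?thesis
    by (rule classify_step[of 0, OF _ _ assms]) (use 1 in simp_all)
qed

section \<open>Identification of the standard positions\<close>

lemma d_eq:
  "d 0 = \<epsilon> 1 + \<epsilon> 2" "d 1 = \<epsilon> 1 + \<epsilon> 3" "d 2 = \<epsilon> 1 + \<epsilon> 5" "d 3 = \<epsilon> 1 + \<epsilon> 9" "d 7 = f\<^sub>2"
  by (simp_all add: glue_def half_vec_supp f\<^sub>2_eq)

lemma f\<^sub>1_eq: "f\<^sub>1 = d 3 + d 7"
proof -
  have "(\<Sum>i=1..8. \<epsilon> i) = \<epsilon> 1 + (\<Sum>i=2..8. \<epsilon> i)"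
    using sum.atLeast_Suc_atMost[of 1 8 \<epsilon>] by (simp add: numeral_2_eq_2)
  then show ?thesis
    unfolding d_eq f\<^sub>1_def f\<^sub>2_def by (simp only: vec_eq_iff vector_add_component
      vector_scaleR_component vector_uminus_component) (simp add: algebra_simps)
qed

lemma BW16_gens_mem:
  "1 \<le> i \<Longrightarrow> i \<le> 16 \<Longrightarrow> 2 *\<^sub>R \<epsilon> i \<in> BW16" "f\<^sub>0 \<in> BW16"
  "g\<^sub>1 \<in> BW16" "g\<^sub>2 \<in> BW16" "g\<^sub>3 \<in> BW16" "g\<^sub>4 \<in> BW16" "g\<^sub>5 \<in> BW16" "g\<^sub>6 \<in> BW16"
  "g\<^sub>7 \<in> BW16" "g\<^sub>8 \<in> BW16" "g\<^sub>9 \<in> BW16" "g\<^sub>1\<^sub>0 \<in> BW16" "g\<^sub>1\<^sub>1 \<in> BW16"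
  unfolding BW16_def by (rule zmodule.span_base; blast)+

lemma lat_eqI:
  assumes "G \<subseteq> lat D" "BW16 \<subseteq> zmodule.span G" "D \<subseteq> zmodule.span G"
  shows "lat D = zmodule.span G"
  using assms unfolding lat_def
  by (intro equalityI zmodule.span_minimal zmodule.subspace_span) auto

lemma pm_mem:
  "\<epsilon> i + \<epsilon> j \<in> pm i j" "\<epsilon> i - \<epsilon> j \<in> pm i j"
  by (simp_all add: pm_def)

section \<open>Root systems forced by pairs of coordinates\<close>

context
  fixes S :: "(real ^ 16) set"
  assumes sub: "zmodule.subspace S"
begin

lemma doubles_mem:
  assumes "pm i j \<subseteq> S"
  shows "2 *\<^sub>R \<epsilon> i \<in> S" "2 *\<^sub>R \<epsilon> j \<in> S"
proof -
  have eq: "2 *\<^sub>R \<epsilon> i = (\<epsilon> i + \<epsilon> j) + (\<epsilon> i - \<epsilon> j)" "2 *\<^sub>R \<epsilon> j = (\<epsilon> i + \<epsilon> j) - (\<epsilon> i - \<epsilon> j)"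
    by (simp_all add: vec_eq_iff)
  have "\<epsilon> i + \<epsilon> j \<in> S" "\<epsilon> i - \<epsilon> j \<in> S"
    using assms pm_mem by blast+
  then show "2 *\<^sub>R \<epsilon> i \<in> S" "2 *\<^sub>R \<epsilon> j \<in> S"
    unfolding eq by (rule zmodule.subspace_add[OF sub] zmodule.subspace_diff[OF sub])+
qed

text \<open>The roots in \<open>A1_16\<close> yield all doubled unit vectors, and
  \<open>g\<^sub>5\<close> to \<open>g\<^sub>1\<^sub>1\<close> are sums of two of them.\<close>

lemma BW16_subset:
  assumes "f\<^sub>0 \<in> S" "g\<^sub>1 \<in> S" "g\<^sub>2 \<in> S" "g\<^sub>3 \<in> S" "g\<^sub>4 \<in> S" and A1: "A1_16 \<subseteq> S"
  shows "BW16 \<subseteq> S"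
proof -
  have pm: "pm (2 * i - 1) (2 * i) \<subseteq> S" if "1 \<le> i" "i \<le> 8" for i
  proof -
    have "pm (2 * i - 1) (2 * i) \<subseteq> A1_16"
      unfolding A1_16_def by (rule UN_upper) (use that in simp)
    then show ?thesis using A1 by blast
  qed
  have pair: "\<epsilon> (2 * i - 1) + \<epsilon> (2 * i) \<in> S" if "1 \<le> i" "i \<le> 8" for i
    using pm[OF that] pm_mem by blast
  have double: "2 *\<^sub>R \<epsilon> i \<in> S" if "1 \<le> i" "i \<le> 16" for i
  proof (cases "even i")
    case True
    then obtain k where "i = 2 * k" by blast
    then show ?thesis using doubles_mem[OF pm[of k]] that by simp
  next
    case False
    then obtain k where "i = 2 * k + 1" by (rule oddE)
    then show ?thesis using doubles_mem(1)[OF pm[of "k + 1"]] that by simp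
  qed
  have sum: "\<epsilon> 1 + \<epsilon> 2 + (\<epsilon> (2 * i - 1) + \<epsilon> (2 * i)) \<in> S" if "1 \<le> i" "i \<le> 8" for i
    using zmodule.subspace_add[OF sub pair[of 1] pair[OF that]] by simp
  have "{g\<^sub>5, g\<^sub>6, g\<^sub>7, g\<^sub>8, g\<^sub>9, g\<^sub>1\<^sub>0, g\<^sub>1\<^sub>1} \<subseteq> S"
    unfolding g\<^sub>5_def g\<^sub>6_def g\<^sub>7_def g\<^sub>8_def g\<^sub>9_def g\<^sub>1\<^sub>0_def g\<^sub>1\<^sub>1_def
    using sum[of 2] sum[of 3] sum[of 4] sum[of 5] sum[of 6] sum[of 7] sum[of 8]
    by (simp add: add.assoc)
  then show ?thesis
    unfolding BW16_def using assms double by (intro zmodule.span_minimal sub) auto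
qed

lemma pm_subset:
  assumes "2 *\<^sub>R \<epsilon> j \<in> S" "\<epsilon> i + \<epsilon> j \<in> S"
  shows "pm i j \<subseteq> S"
proof -
  have "\<epsilon> i - \<epsilon> j \<in> S"
    using zmodule.subspace_diff[OF sub assms(2,1)] by (simp add: scaleR_2)
  then show ?thesis
    using assms(2) zmodule.subspace_neg[OF sub] unfolding pm_def by blast
qed

lemma pair_trans:
  assumes "2 *\<^sub>R \<epsilon> i \<in> S" "\<epsilon> i + \<epsilon> j \<in> S" "\<epsilon> i + \<epsilon> k \<in> S"
  shows "\<epsilon> j + \<epsilon> k \<in> S"
proof -
  have "(\<epsilon> i + \<epsilon> j) + (\<epsilon> i + \<epsilon> k) - 2 *\<^sub>R \<epsilon> i \<in> S"
    by (intro zmodule.subspace_diff[OF sub] zmodule.subspace_add[OF sub] assms)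
  then show ?thesis by (simp add: scaleR_2)
qed

context
  assumes bw: "BW16 \<subseteq> S"
begin

lemma pair_chain:
  assumes "1 \<le> j" "j \<le> 16" "\<epsilon> i + \<epsilon> j \<in> S" "\<epsilon> j + \<epsilon> k \<in> S"
  shows "\<epsilon> i + \<epsilon> k \<in> S"
  using assms bw BW16_gens_mem(1)[of j] pair_trans[of j i k] by (auto simp: add.commute)

lemma pairs_1:
  assumes "\<epsilon> 1 + \<epsilon> 2 \<in> S"
  shows "\<epsilon> 3 + \<epsilon> 4 \<in> S" "\<epsilon> 5 + \<epsilon> 6 \<in> S" "\<epsilon> 7 + \<epsilon> 8 \<in> S" "\<epsilon> 9 + \<epsilon> 10 \<in> S" "\<epsilon> 11 + \<epsilon> 12 \<in> S"
    "\<epsilon> 13 + \<epsilon> 14 \<in> S" "\<epsilon> 15 + \<epsilon> 16 \<in> S"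
proof -
  have *: "x - (\<epsilon> 1 + \<epsilon> 2) \<in> S" if "x \<in> BW16" for x
    using that bw assms by (intro zmodule.subspace_diff[OF sub]) auto
  \<comment> \<open>Item n + 2 of \<open>BW16_gens_mem\<close> concerns the n-th of the
    \<open>g\<close> vectors.\<close>
  show "\<epsilon> 3 + \<epsilon> 4 \<in> S" using *[OF BW16_gens_mem(7)] by (simp add: g\<^sub>5_def)
  show "\<epsilon> 5 + \<epsilon> 6 \<in> S" using *[OF BW16_gens_mem(8)] by (simp add: g\<^sub>6_def)
  show "\<epsilon> 7 + \<epsilon> 8 \<in> S" using *[OF BW16_gens_mem(9)] by (simp add: g\<^sub>7_def)
  show "\<epsilon> 9 + \<epsilon> 10 \<in> S" using *[OF BW16_gens_mem(10)] by (simp add: g\<^sub>8_def)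
  show "\<epsilon> 11 + \<epsilon> 12 \<in> S" using *[OF BW16_gens_mem(11)] by (simp add: g\<^sub>9_def)
  show "\<epsilon> 13 + \<epsilon> 14 \<in> S" using *[OF BW16_gens_mem(12)] by (simp add: g\<^sub>1\<^sub>0_def)
  show "\<epsilon> 15 + \<epsilon> 16 \<in> S" using *[OF BW16_gens_mem(13)] by (simp add: g\<^sub>1\<^sub>1_def)
qed

lemma pairs_2:
  assumes "\<epsilon> 1 + \<epsilon> 3 \<in> S"
  shows "\<epsilon> 5 + \<epsilon> 7 \<in> S" "\<epsilon> 9 + \<epsilon> 11 \<in> S" "\<epsilon> 13 + \<epsilon> 15 \<in> S"
proof -
  have *: "x - (\<epsilon> 1 + \<epsilon> 3) \<in> S" if "x \<in> BW16" for x
    using that bw assms by (intro zmodule.subspace_diff[OF sub]) auto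
  show "\<epsilon> 5 + \<epsilon> 7 \<in> S" using *[OF BW16_gens_mem(4)] by (simp add: g\<^sub>2_def)
  show "\<epsilon> 9 + \<epsilon> 11 \<in> S" using *[OF BW16_gens_mem(5)] by (simp add: g\<^sub>3_def)
  show "\<epsilon> 13 + \<epsilon> 15 \<in> S" using *[OF BW16_gens_mem(6)] by (simp add: g\<^sub>4_def)
qed

lemma pairs_3:
  assumes "\<epsilon> 1 + \<epsilon> 5 \<in> S"
  shows "\<epsilon> 9 + \<epsilon> 13 \<in> S"
proof -
  have "g\<^sub>1 - (\<epsilon> 1 + \<epsilon> 5) \<in> S"
    using bw BW16_gens_mem(3) assms by (intro zmodule.subspace_diff[OF sub]) auto
  then show ?thesis by (simp add: g\<^sub>1_def)
qed

lemma pm_subset_block: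
  assumes "1 \<le> a" "b \<le> 16" "\<And>i. a \<le> i \<Longrightarrow> i \<le> b \<Longrightarrow> \<epsilon> a + \<epsilon> i \<in> S" "a \<le> i" "i \<le> b" "a \<le> j" "j \<le> b"
  shows "pm i j \<subseteq> S"
proof (rule pm_subset)
  have "1 \<le> j" "j \<le> 16" "a \<le> 16" using assms(1,2,6,7) by linarith+
  then show "2 *\<^sub>R \<epsilon> j \<in> S"
    by (intro subsetD[OF bw] BW16_gens_mem(1))
  have "2 *\<^sub>R \<epsilon> a \<in> S"
    by (intro subsetD[OF bw] BW16_gens_mem(1)) fact+
  then show "\<epsilon> i + \<epsilon> j \<in> S"
    by (rule pair_trans) (rule assms(3); fact)+
qed

lemma \<epsilon>_self: "1 \<le> i \<Longrightarrow> i \<le> 16 \<Longrightarrow> \<epsilon> i + \<epsilon> i \<in> S"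
  using bw BW16_gens_mem(1)[of i] by (auto simp: scaleR_2)

lemma A1_16_subset:
  assumes "\<epsilon> 1 + \<epsilon> 2 \<in> S"
  shows "A1_16 \<subseteq> S"
proof -
  have "pm (2 * i - 1) (2 * i) \<subseteq> S" if "i \<in> {1..8}" for i
  proof (rule pm_subset)
    show "2 *\<^sub>R \<epsilon> (2 * i) \<in> S" using bw BW16_gens_mem(1)[of "2 * i"] that by auto
    have "i = 1 \<or> i = 2 \<or> i = 3 \<or> i = 4 \<or> i = 5 \<or> i = 6 \<or> i = 7 \<or> i = 8"
      using that by auto
    then show "\<epsilon> (2 * i - 1) + \<epsilon> (2 * i) \<in> S"
      using assms pairs_1[OF assms] by (elim disjE) simp_all
  qed
  then show ?thesis unfolding A1_16_def by (rule UN_least)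
qed

text \<open>In each block \<open>pairs_1\<close> and \<open>pairs_2\<close> join \<open>a\<close> to
  a + 1 and a + 2; the last index is reached through a + 2.\<close>

lemma block_4:
  assumes "\<epsilon> 1 + \<epsilon> 2 \<in> S" "\<epsilon> 1 + \<epsilon> 3 \<in> S" "a \<in> {1, 5, 9, 13}" "a \<le> i" "i \<le> a + 3"
  shows "\<epsilon> a + \<epsilon> i \<in> S"
proof -
  note p = assms(1,2) pairs_1[OF assms(1)] pairs_2[OF assms(2)]
  have "a = 1 \<and> (i = 1 \<or> i = 2 \<or> i = 3 \<or> i = 4) \<or> a = 5 \<and> (i = 5 \<or> i = 6 \<or> i = 7 \<or> i = 8) \<or>
      a = 9 \<and> (i = 9 \<or> i = 10 \<or> i = 11 \<or> i = 12) \<or> a = 13 \<and> (i = 13 \<or> i = 14 \<or> i = 15 \<or> i = 16)"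
    using assms(3-5) by auto
  then show ?thesis
    using p \<epsilon>_self[of a] pair_chain[of 3 1 4] pair_chain[of 7 5 8] pair_chain[of 11 9 12]
      pair_chain[of 15 13 16] by auto
qed

lemma D4_4_subset:
  assumes "\<epsilon> 1 + \<epsilon> 2 \<in> S" "\<epsilon> 1 + \<epsilon> 3 \<in> S"
  shows "D4_4 \<subseteq> S"
proof -
  have "pm i j \<subseteq> S" if "4 * k - 3 \<le> i" "i < j" "j \<le> 4 * k" "1 \<le> k" "k \<le> 4" for i j k
  proof -
    have "k = 1 \<or> k = 2 \<or> k = 3 \<or> k = 4" using that by auto
    then have "4 * k - 3 \<in> {1, 5, 9, 13}" by auto
    from block_4[OF assms this] show ?thesis
      using that \<open>k = 1 \<or> _\<close> by (intro pm_subset_block[of "4 * k - 3" "4 * k"]) auto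
  qed
  then show ?thesis by (auto simp: D4_4_def)
qed

text \<open>Two blocks of four are joined by \<epsilon> 1 + \<epsilon> 5, and the other two by
  \<epsilon> 9 + \<epsilon> 13, obtained from \<open>g\<^sub>1\<close>.\<close>

lemma block_8:
  assumes "\<epsilon> 1 + \<epsilon> 2 \<in> S" "\<epsilon> 1 + \<epsilon> 3 \<in> S" "\<epsilon> 1 + \<epsilon> 5 \<in> S" "a \<in> {1, 9}" "a \<le> i" "i \<le> a + 7"
  shows "\<epsilon> a + \<epsilon> i \<in> S"
proof (cases "i \<le> a + 3")
  case True
  then show ?thesis using block_4[OF assms(1,2), of a i] assms by auto
next
  case False
  then have "\<epsilon> (a + 4) + \<epsilon> i \<in> S"
    using block_4[OF assms(1,2), of "a + 4" i] assms by auto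
  moreover have "\<epsilon> a + \<epsilon> (a + 4) \<in> S"
    using assms(3,4) pairs_3[OF assms(3)] by auto
  ultimately show ?thesis
    using pair_chain[of "a + 4" a i] assms(4) by auto
qed

lemma D8_D8_subset:
  assumes "\<epsilon> 1 + \<epsilon> 2 \<in> S" "\<epsilon> 1 + \<epsilon> 3 \<in> S" "\<epsilon> 1 + \<epsilon> 5 \<in> S"
  shows "D8_D8 \<subseteq> S"
proof -
  have "pm i j \<subseteq> S" if "1 \<le> i" "i < j" "j \<le> 8" for i j
    using block_8[OF assms, of 1] that by (intro pm_subset_block[of 1 8]) auto
  moreover have "pm i j \<subseteq> S" if "9 \<le> i" "i < j" "j \<le> 16" for i j
    using block_8[OF assms, of 9] that by (intro pm_subset_block[of 9 16]) auto
  ultimately show ?thesis unfolding D8_D8_def by (intro Union_least) blast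
qed

lemma D16_subset:
  assumes "\<epsilon> 1 + \<epsilon> 2 \<in> S" "\<epsilon> 1 + \<epsilon> 3 \<in> S" "\<epsilon> 1 + \<epsilon> 5 \<in> S" "\<epsilon> 1 + \<epsilon> 9 \<in> S"
  shows "D16 \<subseteq> S"
proof -
  have "\<epsilon> 1 + \<epsilon> i \<in> S" if "1 \<le> i" "i \<le> 16" for i
  proof (cases "i \<le> 8")
    case True
    then show ?thesis using block_8[OF assms(1-3), of 1] that by auto
  next
    case False
    then have "\<epsilon> 9 + \<epsilon> i \<in> S" using block_8[OF assms(1-3), of 9] that by auto
    then show ?thesis using pair_chain[of 9 1 i] assms(4) by auto
  qed
  then have "pm i j \<subseteq> S" if "1 \<le> i" "i < j" "j \<le> 16" for i j
    using that by (intro pm_subset_block[of 1 16]) auto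
  then show ?thesis by (auto simp: D16_def)
qed

end

end

lemma D4_4_I: "4 * k - 3 \<le> i \<Longrightarrow> i < j \<Longrightarrow> j \<le> 4 * k \<Longrightarrow> 1 \<le> k \<Longrightarrow> k \<le> 4 \<Longrightarrow> pm i j \<subseteq> D4_4"
  unfolding D4_4_def by blast

lemma A1_16_subset_D4_4: "A1_16 \<subseteq> D4_4"
proof -
  have "pm (2 * i - 1) (2 * i) \<subseteq> D4_4" if "i \<in> {1..8}" for i
    \<comment> \<open>The block of four that contains 2i - 1 and 2i has number (i + 1) div
      2.\<close>
    using that by (intro D4_4_I[of "(i + 1) div 2"]) auto
  then show ?thesis unfolding A1_16_def by (rule UN_least)
qed

lemma D4_4_subset_D8_D8: "D4_4 \<subseteq> D8_D8"
proof -
  have "pm i j \<subseteq> D8_D8" if "4 * k - 3 \<le> i" "i < j" "j \<le> 4 * k" "1 \<le> k" "k \<le> 4" for i j k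
  proof -
    have "1 \<le> i \<and> i < j \<and> j \<le> 8 \<or> 9 \<le> i \<and> i < j \<and> j \<le> 16"
      using that by arith
    then show ?thesis unfolding D8_D8_def by blast
  qed
  then show ?thesis by (auto simp: D4_4_def)
qed

lemma D8_D8_subset_D16: "D8_D8 \<subseteq> D16"
proof -
  have "pm i j \<subseteq> D16" if "1 \<le> i" "i < j" "j \<le> 16" for i j
    using that unfolding D16_def by blast
  then have "pm i j \<subseteq> D16" if "(1 \<le> i \<and> i < j \<and> j \<le> 8) \<or> (9 \<le> i \<and> i < j \<and> j \<le> 16)" for i j
  proof -
    have "1 \<le> i" "i < j" "j \<le> 16" using that by auto
    then show ?thesis by fact
  qed
  then show ?thesis unfolding D8_D8_def by (intro Union_least) blast
qed

lemma A1_16_pairs: "\<epsilon> 1 + \<epsilon> 2 \<in> A1_16"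
  unfolding A1_16_def by (rule UN_I[of 1]) (auto simp: pm_def)

lemma D4_4_pairs:
  "\<epsilon> 1 + \<epsilon> 3 \<in> D4_4" "\<epsilon> 5 + \<epsilon> 7 \<in> D4_4" "\<epsilon> 9 + \<epsilon> 11 \<in> D4_4" "\<epsilon> 13 + \<epsilon> 15 \<in> D4_4"
  using D4_4_I[of 1 1 3] D4_4_I[of 2 5 7] D4_4_I[of 3 9 11] D4_4_I[of 4 13 15] pm_mem by auto

lemma D8_D8_pairs: "\<epsilon> 1 + \<epsilon> 5 \<in> D8_D8" "\<epsilon> 9 + \<epsilon> 13 \<in> D8_D8"
proof -
  have "pm 1 5 \<subseteq> D8_D8" "pm 9 13 \<subseteq> D8_D8"
    unfolding D8_D8_def by (rule Union_upper, fastforce)+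
  then show "\<epsilon> 1 + \<epsilon> 5 \<in> D8_D8" "\<epsilon> 9 + \<epsilon> 13 \<in> D8_D8" using pm_mem by blast+
qed

lemma D16_pairs: "\<epsilon> 1 + \<epsilon> 9 \<in> D16"
proof -
  have "pm 1 9 \<subseteq> D16" unfolding D16_def by (rule Union_upper) fastforce
  then show ?thesis using pm_mem by blast
qed

lemma BW16_subset_if_A1_16:
  assumes "A1_16 \<union> {f\<^sub>0, g\<^sub>1, g\<^sub>2, g\<^sub>3, g\<^sub>4} \<subseteq> G"
  shows "BW16 \<subseteq> zmodule.span G"
  using assms by (intro BW16_subset zmodule.subspace_span) (auto intro: zmodule.span_base)

text \<open>Each of \<open>g\<^sub>2\<close>, \<open>g\<^sub>3\<close>, \<open>g\<^sub>4\<close> is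
  a sum of two roots lying in blocks of four.\<close>

lemma BW16_subset_if_D4_4:
  assumes "D4_4 \<union> {f\<^sub>0, g\<^sub>1} \<subseteq> G"
  shows "BW16 \<subseteq> zmodule.span G"
proof -
  have base: "x \<in> zmodule.span G" if "x \<in> D4_4" for x
    using that assms by (auto intro: zmodule.span_base)
  note p = D4_4_pairs[THEN base]
  have "g\<^sub>2 \<in> zmodule.span G" "g\<^sub>3 \<in> zmodule.span G" "g\<^sub>4 \<in> zmodule.span G"
    unfolding g\<^sub>2_def g\<^sub>3_def g\<^sub>4_def
    using zmodule.span_add[OF p(1) p(2)] zmodule.span_add[OF p(1) p(3)] zmodule.span_add[OF p(1) p(4)]
    by (simp_all add: add.assoc)
  then show ?thesis
    using assms A1_16_subset_D4_4
    by (intro BW16_subset zmodule.subspace_span) (auto intro: zmodule.span_base)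
qed

lemma BW16_subset_if_D8_D8:
  assumes "D8_D8 \<union> {f\<^sub>0} \<subseteq> G"
  shows "BW16 \<subseteq> zmodule.span G"
proof -
  have "g\<^sub>1 \<in> zmodule.span G"
    unfolding g\<^sub>1_def
    using zmodule.span_add[of "\<epsilon> 1 + \<epsilon> 5" G "\<epsilon> 9 + \<epsilon> 13"] D8_D8_pairs assms
    by (auto simp: add.assoc intro: zmodule.span_base)
  then have "BW16 \<subseteq> zmodule.span (G \<union> {g\<^sub>1})"
    using assms D4_4_subset_D8_D8 by (intro BW16_subset_if_D4_4) auto
  also have "\<dots> \<subseteq> zmodule.span G"
    using \<open>g\<^sub>1 \<in> _\<close> by (intro zmodule.span_minimal) (auto intro: zmodule.span_base)
  finally show ?thesis .
qed

lemma BW16_subset_lat: "BW16 \<subseteq> lat D"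
  by (auto simp: lat_def intro: zmodule.span_base)

lemmas lat_mem = subsetD[OF BW16_subset_lat BW16_gens_mem(2)] subsetD[OF BW16_subset_lat BW16_gens_mem(3)]
  subsetD[OF BW16_subset_lat BW16_gens_mem(4)] subsetD[OF BW16_subset_lat BW16_gens_mem(5)]
  subsetD[OF BW16_subset_lat BW16_gens_mem(6)]

lemmas lat_roots = A1_16_subset[OF subspace_lat BW16_subset_lat] D4_4_subset[OF subspace_lat BW16_subset_lat]
  D8_D8_subset[OF subspace_lat BW16_subset_lat] D16_subset[OF subspace_lat BW16_subset_lat]

section \<open>The ten lattices\<close>

lemma lat_BW16: "lat {} = BW16"
  by (simp add: lat_def BW16_eq)

lemma lat_O16: "lat {f\<^sub>1} = O16"
  unfolding O16_def
proof (rule lat_eqI)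
  show "{2 *\<^sub>R \<epsilon> i | i. 1 \<le> i \<and> i \<le> 16} \<union>
      {f\<^sub>0, f\<^sub>1, g\<^sub>1, g\<^sub>2, g\<^sub>3, g\<^sub>4, g\<^sub>5, g\<^sub>6, g\<^sub>7, g\<^sub>8, g\<^sub>9, g\<^sub>1\<^sub>0, g\<^sub>1\<^sub>1} \<subseteq> lat {f\<^sub>1}"
    using BW16_gens_mem BW16_subset_lat[of "{f\<^sub>1}"] lat_base[of "f\<^sub>1" "{f\<^sub>1}"] by auto
  show "BW16 \<subseteq> zmodule.span ({2 *\<^sub>R \<epsilon> i | i. 1 \<le> i \<and> i \<le> 16} \<union>
      {f\<^sub>0, f\<^sub>1, g\<^sub>1, g\<^sub>2, g\<^sub>3, g\<^sub>4, g\<^sub>5, g\<^sub>6, g\<^sub>7, g\<^sub>8, g\<^sub>9, g\<^sub>1\<^sub>0, g\<^sub>1\<^sub>1})"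
    unfolding BW16_def by (intro zmodule.span_mono) auto
qed (auto intro: zmodule.span_base)

lemma lat_A1_16:
  "lat {\<epsilon> 1 + \<epsilon> 2} = \<Lambda>21'"
  "lat {f\<^sub>1, \<epsilon> 1 + \<epsilon> 2} = \<Lambda>21"
  unfolding \<Lambda>21'_def \<Lambda>21_def using A1_16_pairs
  by (intro lat_eqI BW16_subset_if_A1_16; simp add: lat_roots lat_mem lat_base zmodule.span_base subset_insertI2)+

lemma lat_D4_4:
  "lat {\<epsilon> 1 + \<epsilon> 2, \<epsilon> 1 + \<epsilon> 3} = \<Lambda>22'"
  "lat {f\<^sub>1, \<epsilon> 1 + \<epsilon> 2, \<epsilon> 1 + \<epsilon> 3} = \<Lambda>22"
  unfolding \<Lambda>22'_def \<Lambda>22_def using subsetD[OF A1_16_subset_D4_4 A1_16_pairs] D4_4_pairs(1)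
  by (intro lat_eqI BW16_subset_if_D4_4; simp add: lat_roots lat_mem lat_base zmodule.span_base subset_insertI2)+

lemma D8_D8_pairs':
  "\<epsilon> 1 + \<epsilon> 2 \<in> D8_D8" "\<epsilon> 1 + \<epsilon> 3 \<in> D8_D8" "\<epsilon> 1 + \<epsilon> 5 \<in> D8_D8"
  using A1_16_subset_D4_4 D4_4_subset_D8_D8 A1_16_pairs D4_4_pairs(1) D8_D8_pairs(1) by blast+

lemma lat_D8_D8:
  "lat {\<epsilon> 1 + \<epsilon> 2, \<epsilon> 1 + \<epsilon> 3, \<epsilon> 1 + \<epsilon> 5} = \<Lambda>23'"
  "lat {f\<^sub>1, \<epsilon> 1 + \<epsilon> 2, \<epsilon> 1 + \<epsilon> 3, \<epsilon> 1 + \<epsilon> 5} = \<Lambda>23"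
  "lat {f\<^sub>2, \<epsilon> 1 + \<epsilon> 2, \<epsilon> 1 + \<epsilon> 3, \<epsilon> 1 + \<epsilon> 5} = E8_E8"
  unfolding \<Lambda>23'_def \<Lambda>23_def E8_E8_def using D8_D8_pairs'
  by (intro lat_eqI BW16_subset_if_D8_D8; simp add: lat_roots lat_mem lat_base zmodule.span_base subset_insertI2)+

lemma lat_D16: "lat {\<epsilon> 1 + \<epsilon> 9, \<epsilon> 1 + \<epsilon> 2, \<epsilon> 1 + \<epsilon> 3, \<epsilon> 1 + \<epsilon> 5} = D16_plus"
  unfolding D16_plus_def using D8_D8_subset_D16 subsetD[OF D8_D8_subset_D16] D8_D8_pairs' D16_pairs
  by (intro lat_eqI BW16_subset_if_D8_D8; simp add: lat_roots lat_mem lat_base zmodule.span_base subset_insertI2)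

lemma d_image:
  "d ` {..<0} = {}" "d ` {..<1} = {\<epsilon> 1 + \<epsilon> 2}" "d ` {..<2} = {\<epsilon> 1 + \<epsilon> 2, \<epsilon> 1 + \<epsilon> 3}"
  "d ` {..<3} = {\<epsilon> 1 + \<epsilon> 2, \<epsilon> 1 + \<epsilon> 3, \<epsilon> 1 + \<epsilon> 5}"
  "d ` {..<4} = {\<epsilon> 1 + \<epsilon> 9, \<epsilon> 1 + \<epsilon> 2, \<epsilon> 1 + \<epsilon> 3, \<epsilon> 1 + \<epsilon> 5}"
proof -
  \<comment> \<open>The index 3 is put first so that the image is literally the set in
    \<open>lat_D16\<close>.\<close>
  have sets: "{..<1} = {0::nat}" "{..<2} = {0, 1::nat}" "{..<3} = {0, 1, 2::nat}" "{..<4} = {3, 0, 1, 2::nat}"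
    by auto
  show "d ` {..<0} = {}" by simp
  show "d ` {..<1} = {\<epsilon> 1 + \<epsilon> 2}" "d ` {..<2} = {\<epsilon> 1 + \<epsilon> 2, \<epsilon> 1 + \<epsilon> 3}"
    "d ` {..<3} = {\<epsilon> 1 + \<epsilon> 2, \<epsilon> 1 + \<epsilon> 3, \<epsilon> 1 + \<epsilon> 5}"
    "d ` {..<4} = {\<epsilon> 1 + \<epsilon> 9, \<epsilon> 1 + \<epsilon> 2, \<epsilon> 1 + \<epsilon> 3, \<epsilon> 1 + \<epsilon> 5}"
    unfolding sets image_insert image_empty d_eq by (rule refl)+
qed

lemma types_subset: "types \<subseteq> {BW16, O16, \<Lambda>21, \<Lambda>22, \<Lambda>23, \<Lambda>21', \<Lambda>22', \<Lambda>23', D16_plus, E8_E8}"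
proof -
  have even: "lat (d ` {..<j}) \<in> {BW16, \<Lambda>21', \<Lambda>22', \<Lambda>23', D16_plus}" if "j \<le> 4" for j
  proof -
    have "j = 0 \<or> j = 1 \<or> j = 2 \<or> j = 3 \<or> j = 4" using that by auto
    then show ?thesis
      by (elim disjE) (simp_all only: d_image lat_BW16 lat_A1_16 lat_D4_4 lat_D8_D8 lat_D16 insert_iff simp_thms)
  qed
  have odd: "lat (insert (d 3 + d 7) (d ` {..<j})) \<in> {O16, \<Lambda>21, \<Lambda>22, \<Lambda>23}" if "j \<le> 3" for j
  proof -
    have "j = 0 \<or> j = 1 \<or> j = 2 \<or> j = 3" using that by auto
    then show ?thesis
      unfolding f\<^sub>1_eq[symmetric]
      by (elim disjE) (simp_all only: d_image lat_O16 lat_A1_16 lat_D4_4 lat_D8_D8 insert_iff simp_thms)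
  qed
  have E8: "lat (insert (d 7) (d ` {..<3})) = E8_E8"
    unfolding d_image d_eq(5) lat_D8_D8 ..
  show ?thesis
  proof
    fix N assume "N \<in> types"
    then consider j where "j \<le> 4" "N = lat (d ` {..<j})"
      | j where "j \<le> 3" "N = lat (insert (d 3 + d 7) (d ` {..<j}))"
      | "N = lat (insert (d 7) (d ` {..<3}))"
      unfolding types_def by blast
    then show "N \<in> {BW16, O16, \<Lambda>21, \<Lambda>22, \<Lambda>23, \<Lambda>21', \<Lambda>22', \<Lambda>23', D16_plus, E8_E8}"
    proof cases
      case (1 j)
      from even[OF 1(1)] show ?thesis unfolding 1(2) insert_iff empty_iff by argo
    next
      case (2 j)
      from odd[OF 2(1)] show ?thesis unfolding 2(2) insert_iff empty_iff by argo
    next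
      case 3
      show ?thesis unfolding 3 E8 by simp
    qed
  qed
qed

theorem theorem1p1:
  fixes M :: "(real ^ 16) set"
  assumes "integral_lattice M" and "BW16 \<subseteq> M"
  shows "\<exists>N \<in> {BW16, O16, \<Lambda>21, \<Lambda>22, \<Lambda>23, \<Lambda>21', \<Lambda>22', \<Lambda>23', D16_plus, E8_E8}. isometric M N"
proof -
  have "overlattice M"
    using assms by (auto simp: overlattice_def integral_lattice_def is_lattice_def)
  then obtain N where "N \<in> types" "isometric M N"
    using classification by blast
  with subsetD[OF types_subset] show ?thesis by (intro bexI)
qed

end
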